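(* The kernel and range of the forward shift operator $Z_+:\mathcal{H}(\Lambda)\to\mathcal{H}(\Lambda)$, $$(Z_+f)(z)=\frac{f(0)-f(z)}{2}+\int_0^z f\,\delta z,$$ are $$\ker(Z_+)=\{0\},\qquad \operatorname{ran}(Z_+)=\{f\in\mathcal{H}(\Lambda): f(0)=0\}.$$
   Context: **Lattice.** $\Lambda$ is a rhombic lattice in the complex plane $\mathbb{C}$: a monohedral (all tiles congruent), edge-to-edge tessellation of $\mathbb{C}$ with rhombi of side length $1$. $V(\Lambda)$ is its set of vertices; two vertices are adjacent if they are the endpoints of an edge of $\Lambda$. A path in $\Lambda$ from $a$ to $b$ is a finite sequence $(z_0,\dots,z_N)$ of vertices with $z_0=a$, $z_N=b$ and $z_{n-1},z_n$ adjacent for $n=1,\dots,N$; it is closed if $a=b$. Standing assumptions on $\Lambda$: (i) $0\in V(\Lambda)$; (ii) for every $z\in V(\Lambda)$ there are $N\in\mathbb{N}$ and a path $(z_0,\dots,z_N)$ with $z_0=z$, $z_n-z_{n-1}\neq\pm1$ for $n=1,\dots,N-1$, and $z_N-z_{N-1}=1$. **Discrete analyticity.** For $f:V(\Lambda)\to\mathbb{C}$ and a path $\gamma=(z_0,\dots,z_N)$, $\int_\gamma f\,\delta z=\sum_{n=1}^N\frac{f(z_{n-1})+f(z_n)}{2}(z_n-z_{n-1})$. $f$ is discrete analytic (DA) if $\int_\gamma f\,\delta z=0$ for every closed path $\gamma$; then $\int_a^b f\,\delta z$ denotes $\int_\gamma f\,\delta z$ for any path $\gamma$ from $a$ to $b$.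 $\mathcal{H}(\Lambda)$ is the complex vector space of DA functions on $V(\Lambda)$. It is known that $z\mapsto\int_0^z f\,\delta z$ is DA whenever $f$ is DA, so $Z_+$ maps $\mathcal{H}(\Lambda)$ into itself. *)

theory Defs
  imports "HOL-Analysis.Analysis"
begin

definition unit_rhombus :: "complex set \<Rightarrow> bool" where
  "unit_rhombus R \<longleftrightarrow>
     (\<exists>p u v. norm u = 1 \<and> norm v = 1 \<and> u \<noteq> v \<and> u \<noteq> - v \<and>
        R = convex hull {p, p + u, p + u + v, p + v})"

definition congruent_sets :: "complex set \<Rightarrow> complex set \<Rightarrow> bool" where
  "congruent_sets R S \<longleftrightarrow>
     (\<exists>c h. orthogonal_transformation h \<and> S = (\<lambda>x. c + h x) ` R)"

text \<open>
  A lattice is given by its set of (closed) tiles. The face condition is edge-to-edgeness: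
  two distinct tiles are disjoint or meet exactly in a common vertex or a common edge
  (a tile that is itself a face of another tile is excluded by disjointness of the interiors).
\<close>

definition rhombic_lattice :: "complex set set \<Rightarrow> bool" where
  "rhombic_lattice \<Lambda> \<longleftrightarrow>
     (\<forall>R\<in>\<Lambda>. unit_rhombus R) \<and>
     (\<forall>R\<in>\<Lambda>. \<forall>S\<in>\<Lambda>. congruent_sets R S) \<and>
     \<Union>\<Lambda> = UNIV \<and>
     (\<forall>R\<in>\<Lambda>. \<forall>S\<in>\<Lambda>. R \<noteq> S \<longrightarrow> interior R \<inter> interior S = {}) \<and>
     (\<forall>R\<in>\<Lambda>. \<forall>S\<in>\<Lambda>. R \<noteq> S \<longrightarrow> (R \<inter> S) face_of R \<and> (R \<inter> S) face_of S)"

definition verts :: "complex set set \<Rightarrow> complex set" where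
  "verts \<Lambda> = {z. \<exists>R\<in>\<Lambda>. z extreme_point_of R}"

definition adjacent :: "complex set set \<Rightarrow> complex \<Rightarrow> complex \<Rightarrow> bool" where
  "adjacent \<Lambda> a b \<longleftrightarrow>
     a \<in> verts \<Lambda> \<and> b \<in> verts \<Lambda> \<and> (\<exists>R\<in>\<Lambda>. closed_segment a b edge_of R)"

text \<open>The path \<open>(z\<^sub>0, \<dots>, z\<^sub>N)\<close> is a list of length \<open>N + 1\<close>; the case \<open>N = 0\<close> is allowed.\<close>

definition lattice_path :: "complex set set \<Rightarrow> complex list \<Rightarrow> bool" where
  "lattice_path \<Lambda> zs \<longleftrightarrow>
     zs \<noteq> [] \<and> set zs \<subseteq> verts \<Lambda> \<and> (\<forall>n\<in>{1..<length zs}. adjacent \<Lambda> (zs ! (n - 1)) (zs ! n))"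

definition path_from_to :: "complex set set \<Rightarrow> complex list \<Rightarrow> complex \<Rightarrow> complex \<Rightarrow> bool" where
  "path_from_to \<Lambda> zs a b \<longleftrightarrow> lattice_path \<Lambda> zs \<and> hd zs = a \<and> last zs = b"

definition path_integral :: "(complex \<Rightarrow> complex) \<Rightarrow> complex list \<Rightarrow> complex" where
  "path_integral f zs =
     (\<Sum>n\<in>{1..<length zs}. (f (zs ! (n - 1)) + f (zs ! n)) / 2 * (zs ! n - zs ! (n - 1)))"

definition discrete_analytic :: "complex set set \<Rightarrow> (complex \<Rightarrow> complex) \<Rightarrow> bool" where
  "discrete_analytic \<Lambda> f \<longleftrightarrow> (\<forall>a zs. path_from_to \<Lambda> zs a a \<longrightarrow> path_integral f zs = 0)"

text \<open>Independent of the chosen path when \<open>f\<close> is discrete analytic; meaningful only then.\<close>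

definition discrete_integral ::
    "complex set set \<Rightarrow> (complex \<Rightarrow> complex) \<Rightarrow> complex \<Rightarrow> complex \<Rightarrow> complex" where
  "discrete_integral \<Lambda> f a b = path_integral f (SOME zs. path_from_to \<Lambda> zs a b)"

text \<open>
  A function on the vertex set is encoded as a function on the whole plane that vanishes at
  all non-vertices, so that equality of encodings is equality of functions on the vertex set
  and the zero function is the zero of the space.
\<close>

definition DA_space :: "complex set set \<Rightarrow> (complex \<Rightarrow> complex) set" where
  "DA_space \<Lambda> = {f. (\<forall>z. z \<notin> verts \<Lambda> \<longrightarrow> f z = 0) \<and> discrete_analytic \<Lambda> f}"

definition Z_plus :: "complex set set \<Rightarrow> (complex \<Rightarrow> complex) \<Rightarrow> complex \<Rightarrow> complex" where
  "Z_plus \<Lambda> f z =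
     (if z \<in> verts \<Lambda> then (f 0 - f z) / 2 + discrete_integral \<Lambda> f 0 z else 0)"

end

theory Submission
  imports Defs
begin

text \<open>
  Write \<open>d = b - a\<close> for the direction of an edge from \<open>a\<close> to \<open>b\<close>. If \<open>F\<close> is the forward shift of
  \<open>f\<close>, the definition of the integral gives the edge equations
  \<open>(d - 1) f(b) + (d + 1) f(a) = 2 (F(b) - F(a))\<close>, and conversely a solution \<open>f\<close> of the edge
  equations of some \<open>F\<close> with \<open>F(0) = 0\<close> is automatically discrete analytic (\<open>F + f / 2\<close> is a
  primitive of it) and is mapped to \<open>F\<close> (\<open>Z_plus_eqI\<close>). The theorem is therefore about solving
  the edge equations.

  Injectivity: for \<open>F = 0\<close> a horizontal edge from \<open>a\<close> to \<open>a + 1\<close> forces \<open>f(a) = 0\<close>, and along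
  any other edge the vanishing of \<open>f\<close> propagates. By assumption each vertex is joined by
  non-horizontal edges to the left end of a horizontal one.

  Everything else rests on a discrete Poincare lemma (\<open>edge_potential\<close>): an antisymmetric
  function on oriented edges whose sum around each tile vanishes is a difference \<open>P(b) - P(a)\<close>.
  A choice of potentials on the single tiles defines an additive cocycle on pairs of
  intersecting tiles, and such a cocycle splits because the plane is simply connected;
  concretely it splits on small rectangles, hence on all rectangles by gluing along common
  sides, hence on the plane (\<open>cocycle_splits\<close>). As a consequence discrete analyticity is a
  condition on each tile separately (\<open>discrete_analytic_iff\<close>), the discrete Cauchy-Riemann
  equation, and the forward shift preserves it by direct calculation.

  Surjectivity: let \<open>F\<close> satisfy the Cauchy-Riemann equation. On non-horizontal edges the
  homogeneous equation is solved by a discrete exponential \<open>E\<close>, and with \<open>f = E g\<close> the edge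
  equation prescribes the increments of \<open>g\<close>. On horizontal edges it degenerates to
  \<open>f(p) = F(p + 1) - F(p)\<close>, a condition on the left end alone. The tiles with horizontal edges
  are stacked in strips that climb through all heights, and along each strip the prescribed
  increments on the left and on the right side can be completed by increments across the strip
  to a closed edge function (\<open>strip_summation\<close>), so \<open>g\<close> exists. The degenerate conditions hold
  up to a constant for each strip. To remove these constants one must see that different strips
  bound different regions on their left. For this, let the level of a vertex increase by one
  across each strip, from left to right, and be constant along non-horizontal edges. Extended to
  the plane, the level is monotone on horizontal lines and increases strictly across a strip,
  hence two strips with the same level on their left coincide (\<open>same_level_same_strip\<close>). The
  constants thus depend on the level only, and subtracting a function of the level from \<open>g\<close> does
  not disturb the equations on the non-horizontal edges.
\<close>

section \<open>Geometry of a unit rhombus\<close>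

definition rhomb :: "complex \<Rightarrow> complex \<Rightarrow> complex \<Rightarrow> complex set" where
  "rhomb p u v = convex hull {p, p + u, p + u + v, p + v}"

definition rhombus_sides :: "complex \<Rightarrow> complex \<Rightarrow> bool" where
  "rhombus_sides u v \<longleftrightarrow> norm u = 1 \<and> norm v = 1 \<and> u \<noteq> v \<and> u \<noteq> - v"

lemma unit_rhombus_iff: "unit_rhombus R \<longleftrightarrow> (\<exists>p u v. rhombus_sides u v \<and> R = rhomb p u v)"
  unfolding unit_rhombus_def rhomb_def rhombus_sides_def by auto

lemma rhomb_swap: "rhomb p u v = rhomb p v u"
proof -
  have "{p, p + u, p + u + v, p + v} = {p, p + v, p + v + u, p + u}"
    by (auto simp: algebra_simps)
  then show ?thesis unfolding rhomb_def by simp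
qed

lemma rhomb_shift: "rhomb p u v = rhomb (p + u) (- u) v"
proof -
  have "{p, p + u, p + u + v, p + v} = {p + u, p + u + - u, p + u + - u + v, p + u + v}"
    by auto
  then show ?thesis unfolding rhomb_def by simp
qed

lemma rhombus_sides_swap: "rhombus_sides u v \<Longrightarrow> rhombus_sides v u"
  unfolding rhombus_sides_def by auto

lemma rhombus_sides_neg: "rhombus_sides u v \<Longrightarrow> rhombus_sides (- u) v"
  unfolding rhombus_sides_def by auto

lemma rhombus_sides_nonzero: "rhombus_sides u v \<Longrightarrow> u \<noteq> 0 \<and> v \<noteq> 0"
  unfolding rhombus_sides_def by auto

lemma unit_complex_Im_0:
  fixes d :: complex
  assumes "norm d = 1" "Im d = 0"
  shows "d = 1 \<or> d = - 1"
proof -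
  have "\<bar>Re d\<bar> = 1" using assms by (simp add: cmod_def)
  then show ?thesis using assms by (auto simp: complex_eq_iff)
qed

lemma rhombus_sides_independent:
  assumes "rhombus_sides u v"
  shows "Im (cnj u * v) \<noteq> 0"
proof
  assume "Im (cnj u * v) = 0"
  moreover have "norm (cnj u * v) = 1"
    using assms by (simp add: rhombus_sides_def norm_mult)
  ultimately have 1: "cnj u * v = 1 \<or> cnj u * v = - 1"
    using unit_complex_Im_0 by blast
  have "u * cnj u = 1"
    using assms complex_norm_square[of u] by (simp add: rhombus_sides_def)
  then have v: "v = u * (cnj u * v)" by (simp add: mult.assoc[symmetric])
  from 1 have "v = u \<or> v = - u" by (elim disjE; subst v) simp_all
  then show False using assms by (auto simp: rhombus_sides_def)
qed

lemma rhomb_coordinates: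
  "rhomb p u v = {p + of_real s * u + of_real t * v | s t. 0 \<le> s \<and> s \<le> 1 \<and> 0 \<le> t \<and> t \<le> 1}"
    (is "_ = ?P")
proof
  have "convex ?P"
  proof (rule convexI)
    fix x y and a b :: real
    assume "x \<in> ?P" "y \<in> ?P" and ab: "0 \<le> a" "0 \<le> b" "a + b = 1"
    then obtain s t s' t' where
      x: "x = p + of_real s * u + of_real t * v" and st: "0 \<le> s" "s \<le> 1" "0 \<le> t" "t \<le> 1" and
      y: "y = p + of_real s' * u + of_real t' * v" and
      st': "0 \<le> s'" "s' \<le> 1" "0 \<le> t'" "t' \<le> 1" by blast
    have b: "b = 1 - a" using ab by simp
    have "a *\<^sub>R x + b *\<^sub>R y = p + of_real (a * s + b * s') * u + of_real (a * t + b * t') * v"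
      unfolding x y b by (simp add: scaleR_conv_of_real algebra_simps)
    moreover have "a * s + b * s' \<le> 1" "a * t + b * t' \<le> 1"
      using ab st st' convex_bound_le by metis+
    ultimately show "a *\<^sub>R x + b *\<^sub>R y \<in> ?P"
      using ab st st' by (smt (verit, best) mem_Collect_eq mult_nonneg_nonneg)
  qed
  moreover have "{p, p + u, p + u + v, p + v} \<subseteq> ?P"
  proof -
    have "p = p + of_real 0 * u + of_real 0 * v" "p + u = p + of_real 1 * u + of_real 0 * v"
      "p + u + v = p + of_real 1 * u + of_real 1 * v" "p + v = p + of_real 0 * u + of_real 1 * v"
      by auto
    then show ?thesis by (smt (verit, best) empty_subsetI insert_subset mem_Collect_eq)
  qed
  ultimately show "rhomb p u v \<subseteq> ?P"
    unfolding rhomb_def by (simp add: hull_minimal)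
next
  show "?P \<subseteq> rhomb p u v"
  proof
    fix x assume "x \<in> ?P"
    then obtain s t where x: "x = p + of_real s * u + of_real t * v"
      and st: "0 \<le> s" "s \<le> 1" "0 \<le> t" "t \<le> 1" by blast
    have cv: "convex (rhomb p u v)" unfolding rhomb_def by (rule convex_convex_hull)
    have vs: "p \<in> rhomb p u v" "p + u \<in> rhomb p u v" "p + u + v \<in> rhomb p u v" "p + v \<in> rhomb p u v"
      unfolding rhomb_def by (auto intro: hull_inc)
    have 1: "(1 - s) *\<^sub>R p + s *\<^sub>R (p + u) \<in> rhomb p u v"
      using convexD_alt[OF cv vs(1,2)] st by blast
    have 2: "(1 - s) *\<^sub>R (p + v) + s *\<^sub>R (p + u + v) \<in> rhomb p u v"
      using convexD_alt[OF cv vs(4,3)] st by blast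
    have "(1 - t) *\<^sub>R ((1 - s) *\<^sub>R p + s *\<^sub>R (p + u)) + t *\<^sub>R ((1 - s) *\<^sub>R (p + v) + s *\<^sub>R (p + u + v)) \<in> rhomb p u v"
      using convexD_alt[OF cv 1 2] st by blast
    also have "(1 - t) *\<^sub>R ((1 - s) *\<^sub>R p + s *\<^sub>R (p + u)) + t *\<^sub>R ((1 - s) *\<^sub>R (p + v) + s *\<^sub>R (p + u + v)) = x"
      unfolding x by (simp add: scaleR_conv_of_real algebra_simps)
    finally show "x \<in> rhomb p u v" .
  qed
qed

lemma rhomb_memI:
  "0 \<le> s \<Longrightarrow> s \<le> 1 \<Longrightarrow> 0 \<le> t \<Longrightarrow> t \<le> 1 \<Longrightarrow> p + of_real s * u + of_real t * v \<in> rhomb p u v"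
  unfolding rhomb_coordinates by blast

lemma rhomb_memE:
  assumes "x \<in> rhomb p u v"
  obtains s t where "x = p + of_real s * u + of_real t * v" "0 \<le> s" "s \<le> 1" "0 \<le> t" "t \<le> 1"
  using assms unfolding rhomb_coordinates by blast

lemma rhomb_corners:
  "p \<in> rhomb p u v" "p + u \<in> rhomb p u v" "p + u + v \<in> rhomb p u v" "p + v \<in> rhomb p u v"
  unfolding rhomb_def by (auto intro: hull_inc)

lemma convex_rhomb: "convex (rhomb p u v)"
  unfolding rhomb_def by (rule convex_convex_hull)

lemma compact_rhomb: "compact (rhomb p u v)"
  unfolding rhomb_def by (intro compact_convex_hull finite_imp_compact) auto

text \<open>The area form with one side measures the coordinate along the other, continuously in the point.\<close>

lemma coordinate_along_second_side:
  "Im (cnj u * (p + of_real s * u + of_real t * v - p)) = t * Im (cnj u * v)"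
  by (simp add: algebra_simps)

lemma coordinate_along_first_side:
  "Im (cnj v * (p + of_real s * u + of_real t * v - p)) = - s * Im (cnj u * v)"
  by (simp add: algebra_simps)

lemma coordinates_unique:
  assumes "rhombus_sides u v"
    and "p + of_real s * u + of_real t * v = p + of_real s' * u + of_real t' * v"
  shows "s = s' \<and> t = t'"
  using rhombus_sides_independent[OF assms(1)]
    coordinate_along_second_side[of u p s t v] coordinate_along_second_side[of u p s' t' v]
    coordinate_along_first_side[of v p s u t] coordinate_along_first_side[of v p s' u t']
  unfolding assms(2) by (metis mult_cancel_right neg_equal_iff_equal)

lemma rhombus_sides_span:
  assumes "rhombus_sides u v"
  obtains s t where "z = p + of_real s * u + of_real t * v"
proof -
  let ?D = "Im (cnj u * v)"
  have D: "?D \<noteq> 0" by (rule rhombus_sides_independent[OF assms])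
  define s t where "s = - Im (cnj v * (z - p)) / ?D" and "t = Im (cnj u * (z - p)) / ?D"
  have st: "s * ?D = - Im (cnj v * (z - p))" "t * ?D = Im (cnj u * (z - p))"
    using D unfolding s_def t_def by simp_all
  have "of_real ?D * (z - p) = of_real (s * ?D) * u + of_real (t * ?D) * v"
    unfolding st by (simp add: complex_eq_iff algebra_simps)
  also have "\<dots> = of_real ?D * (of_real s * u + of_real t * v)"
    by (simp add: algebra_simps)
  finally have "z - p = of_real s * u + of_real t * v"
    using D by (metis mult_cancel_left of_real_eq_0_iff)
  then have "z = p + of_real s * u + of_real t * v" by (simp add: algebra_simps)
  then show ?thesis by (rule that)
qed

lemma rhomb_interiorI:
  assumes sides: "rhombus_sides u v" and st: "0 < s" "s < 1" "0 < t" "t < 1"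
  shows "p + of_real s * u + of_real t * v \<in> interior (rhomb p u v)"
proof -
  let ?D = "Im (cnj u * v)"
  have D: "?D \<noteq> 0" by (rule rhombus_sides_independent[OF sides])
  let ?s = "\<lambda>x. - Im (cnj v * (x - p)) / ?D" and ?t = "\<lambda>x. Im (cnj u * (x - p)) / ?D"
  define U where "U = {x. 0 < ?s x \<and> ?s x < 1 \<and> 0 < ?t x \<and> ?t x < 1}"
  have st': "?s (p + of_real s * u + of_real t * v) = s" "?t (p + of_real s * u + of_real t * v) = t" for s t
    unfolding coordinate_along_first_side coordinate_along_second_side using D by simp_all
  have "open U" unfolding U_def using D
    by (intro open_Collect_conj open_Collect_less continuous_intros) auto
  moreover have "U \<subseteq> rhomb p u v"
  proof
    fix x assume x: "x \<in> U"
    obtain s t where e: "x = p + of_real s * u + of_real t * v"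
      using rhombus_sides_span[OF sides] .
    show "x \<in> rhomb p u v"
      using x unfolding e U_def mem_Collect_eq st' by (intro rhomb_memI) auto
  qed
  moreover have "p + of_real s * u + of_real t * v \<in> U"
    using st unfolding U_def mem_Collect_eq st' by blast
  ultimately show ?thesis using interiorI by blast
qed

lemma rhomb_side_edge:
  assumes sides: "rhombus_sides u v"
  shows "closed_segment p (p + u) edge_of rhomb p u v"
proof -
  let ?D = "Im (cnj u * v)"
  have D: "?D \<noteq> 0" by (rule rhombus_sides_independent[OF sides])
  \<comment> \<open>The side lies on the line where the second coordinate vanishes.\<close>
  define c where "c = of_real ?D * (\<i> * u)"
  have ip: "c \<bullet> x - c \<bullet> p = ?D * Im (cnj u * (x - p))" for x
    unfolding c_def by (simp add: inner_complex_def algebra_simps)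
  have ip2: "c \<bullet> (p + of_real s * u + of_real t * v) = c \<bullet> p + t * ?D\<^sup>2" for s t
    using ip[of "p + of_real s * u + of_real t * v"] coordinate_along_second_side[of u p s t v]
    by (simp add: power2_eq_square algebra_simps)
  have "rhomb p u v \<inter> {x. c \<bullet> x = c \<bullet> p} face_of rhomb p u v"
  proof (rule face_of_Int_supporting_hyperplane_ge[OF convex_rhomb])
    fix x assume "x \<in> rhomb p u v"
    then show "c \<bullet> p \<le> c \<bullet> x" by (rule rhomb_memE) (simp add: ip2)
  qed
  moreover have "rhomb p u v \<inter> {x. c \<bullet> x = c \<bullet> p} = closed_segment p (p + u)"
  proof -
    have "x \<in> rhomb p u v \<and> c \<bullet> x = c \<bullet> p \<longleftrightarrow> (\<exists>s. x = p + of_real s * u \<and> 0 \<le> s \<and> s \<le> 1)" for x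
    proof
      assume x: "x \<in> rhomb p u v \<and> c \<bullet> x = c \<bullet> p"
      then obtain s t where e: "x = p + of_real s * u + of_real t * v" "0 \<le> s" "s \<le> 1"
        by (meson rhomb_memE)
      then have "t = 0" using ip2 x D by simp
      then show "\<exists>s. x = p + of_real s * u \<and> 0 \<le> s \<and> s \<le> 1" using e by auto
    next
      assume "\<exists>s. x = p + of_real s * u \<and> 0 \<le> s \<and> s \<le> 1"
      then obtain s where e: "x = p + of_real s * u + of_real 0 * v" "0 \<le> s" "s \<le> 1" by auto
      then show "x \<in> rhomb p u v \<and> c \<bullet> x = c \<bullet> p"
        using rhomb_memI[of s 0 p u v] ip2[of s 0] by auto
    qed
    moreover have "x \<in> closed_segment p (p + u) \<longleftrightarrow> (\<exists>s. x = p + of_real s * u \<and> 0 \<le> s \<and> s \<le> 1)" for x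
      by (auto simp: in_segment scaleR_conv_of_real algebra_simps)
    ultimately show ?thesis by blast
  qed
  moreover have "aff_dim (closed_segment p (p + u)) = 1"
    using rhombus_sides_nonzero[OF sides] by (simp add: segment_convex_hull aff_dim_convex_hull)
  ultimately show ?thesis unfolding edge_of_def by simp
qed

lemma rhomb_side_edges:
  assumes "rhombus_sides u v"
  shows "closed_segment p (p + u) edge_of rhomb p u v"
    and "closed_segment p (p + v) edge_of rhomb p u v"
    and "closed_segment (p + u) (p + u + v) edge_of rhomb p u v"
    and "closed_segment (p + v) (p + u + v) edge_of rhomb p u v"
proof -
  show "closed_segment p (p + u) edge_of rhomb p u v" by (rule rhomb_side_edge[OF assms])
  show "closed_segment p (p + v) edge_of rhomb p u v"
    using rhomb_side_edge[OF rhombus_sides_swap[OF assms], of p] rhomb_swap by metis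
  show "closed_segment (p + u) (p + u + v) edge_of rhomb p u v"
    using rhomb_side_edge[OF rhombus_sides_swap[OF rhombus_sides_neg[OF assms]], of "p + u"]
      rhomb_swap rhomb_shift by metis
  have "rhomb p u v = rhomb (p + v) u (- v)" using rhomb_swap rhomb_shift by metis
  moreover have "rhombus_sides u (- v)"
    using assms rhombus_sides_swap rhombus_sides_neg by blast
  ultimately show "closed_segment (p + v) (p + u + v) edge_of rhomb p u v"
    using rhomb_side_edge[of u "- v" "p + v"] by (simp add: add.commute add.left_commute)
qed

lemma rhomb_extreme_points:
  assumes "rhombus_sides u v"
  shows "x extreme_point_of rhomb p u v \<longleftrightarrow> x \<in> {p, p + u, p + u + v, p + v}"
proof
  assume "x extreme_point_of rhomb p u v"
  then show "x \<in> {p, p + u, p + u + v, p + v}"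
    unfolding rhomb_def by (rule extreme_point_of_convex_hull)
next
  have "a extreme_point_of R \<and> b extreme_point_of R" if "closed_segment a b edge_of R"
    for a b :: complex and R
    using that extreme_point_of_face extreme_point_of_segment unfolding edge_of_def by blast
  note * = this
  assume "x \<in> {p, p + u, p + u + v, p + v}"
  then show "x extreme_point_of rhomb p u v"
    using *[OF rhomb_side_edges(1)[OF assms]] *[OF rhomb_side_edges(4)[OF assms]] by auto
qed

lemma subset_of_four:
  assumes "T \<subseteq> {a, b, c, d}" "\<not> (a \<in> T \<and> c \<in> T)" "\<not> (b \<in> T \<and> d \<in> T)" "T \<noteq> {}"
  shows "T \<in> {{a}, {b}, {c}, {d}, {a, b}, {a, d}, {b, c}, {d, c}}"
proof -
  have "T \<subseteq> {a, b} \<or> T \<subseteq> {a, d} \<or> T \<subseteq> {b, c} \<or> T \<subseteq> {d, c}"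
    using assms(1,2,3) by blast
  moreover have two: "T = {x} \<or> T = {y} \<or> T = {x, y}" if "T \<subseteq> {x, y}" for x y
    using that assms(4) by blast
  ultimately show ?thesis by (elim disjE) (drule two, elim disjE, simp_all)+
qed

text \<open>
  A face of the hull is the hull of some of the corners. It cannot contain two opposite corners,
  because then it would contain the centre, which is also the midpoint of the other diagonal.
\<close>

lemma rhomb_proper_face:
  assumes sides: "rhombus_sides u v" and F: "F face_of rhomb p u v" "F \<noteq> {}" "F \<noteq> rhomb p u v"
  shows "(\<exists>a\<in>{p, p + u, p + u + v, p + v}. F = {a}) \<or>
    F \<in> {closed_segment p (p + u), closed_segment p (p + v),
      closed_segment (p + u) (p + u + v), closed_segment (p + v) (p + u + v)}"
proof -
  obtain T where T: "T \<subseteq> {p, p + u, p + u + v, p + v}" "F = convex hull T"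
    using F(1) unfolding rhomb_def by (auto elim: face_of_convex_hull_subset[rotated])
  have cvF: "convex F" using F(1) by (rule face_of_imp_convex)
  have TF: "T \<subseteq> F" unfolding T(2) by (rule hull_subset)
  let ?m = "midpoint p (p + u + v)"
  have m2: "?m = midpoint (p + u) (p + v)" by (simp add: midpoint_def algebra_simps)
  have uv: "u \<noteq> v" "u + v \<noteq> 0" using sides by (auto simp: rhombus_sides_def add_eq_0_iff2)
  have o1: "?m \<in> open_segment p (p + u + v)" using uv by (simp add: midpoint_in_open_segment add.assoc)
  have o2: "?m \<in> open_segment (p + u) (p + v)" unfolding m2 using uv by (simp add: midpoint_in_open_segment)
  have full: False if "?m \<in> F"
  proof -
    have "p \<in> F \<and> p + u + v \<in> F" "p + u \<in> F \<and> p + v \<in> F"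
      using face_ofD[OF F(1) o1] face_ofD[OF F(1) o2] that rhomb_corners by blast+
    then have "rhomb p u v \<subseteq> F" unfolding rhomb_def using cvF by (simp add: hull_minimal)
    then show False using F face_of_imp_subset by blast
  qed
  have "\<not> (p \<in> T \<and> p + u + v \<in> T)"
    using full TF cvF convex_contains_open_segment o1 by blast
  moreover have "\<not> (p + u \<in> T \<and> p + v \<in> T)"
    using full TF cvF convex_contains_open_segment o2 by blast
  moreover have "T \<noteq> {}" using F(2) T(2) by auto
  ultimately have "T \<in> {{p}, {p + u}, {p + u + v}, {p + v}, {p, p + u}, {p, p + v},
      {p + u, p + u + v}, {p + v, p + u + v}}"
    by (rule subset_of_four[OF T(1)])
  then consider a where "a \<in> {p, p + u, p + u + v, p + v}" "T = {a}"
    | "T \<in> {{p, p + u}, {p, p + v}, {p + u, p + u + v}, {p + v, p + u + v}}" by blast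
  then show ?thesis
  proof cases
    case 1
    then show ?thesis unfolding T(2) by (intro disjI1 bexI) auto
  next
    case 2
    then show ?thesis unfolding T(2) segment_convex_hull by blast
  qed
qed

lemma rhomb_nonempty_interior: "rhombus_sides u v \<Longrightarrow> interior (rhomb p u v) \<noteq> {}"
  using rhomb_interiorI[of u v "1/2" "1/2"] by fastforce

lemma rhomb_edge_cases:
  assumes sides: "rhombus_sides u v" and e: "closed_segment a b edge_of rhomb p u v"
  shows "{a, b} \<in> {{p, p + u}, {p, p + v}, {p + u, p + u + v}, {p + v, p + u + v}}"
proof -
  define R where Rp: "R = rhomb p u v"
  note e = e[folded Rp]
  have ad: "aff_dim (closed_segment a b) = 1" and fc: "closed_segment a b face_of R"
    using e by (auto simp: edge_of_def)
  have "a \<noteq> b" using ad by auto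
  have "closed_segment a b \<noteq> R"
  proof
    assume "closed_segment a b = R"
    then have "interior R = {}" using \<open>a \<noteq> b\<close> interior_closed_segment_ge2[of a b] by simp
    then show False using rhomb_nonempty_interior[OF sides] Rp by simp
  qed
  moreover have "closed_segment a b \<noteq> {c}" for c using \<open>a \<noteq> b\<close> by (metis closed_segment_eq_sing)
  moreover have "closed_segment a b \<noteq> {}" by simp
  ultimately have "closed_segment a b \<in> {closed_segment p (p + u), closed_segment p (p + v),
      closed_segment (p + u) (p + u + v), closed_segment (p + v) (p + u + v)}"
    using rhomb_proper_face[OF sides fc[unfolded Rp]] Rp by blast
  then show ?thesis by (simp only: insert_iff empty_iff closed_segment_eq)
qed

lemma rhomb_edge_direction:
  assumes "rhombus_sides u v" "closed_segment a b edge_of rhomb p u v"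
  shows "b - a \<in> {u, - u, v, - v}"
proof -
  have "{a, b} \<in> {{p, p + u}, {p, p + v}, {p + u, p + u + v}, {p + v, p + u + v}}"
    by (rule rhomb_edge_cases[OF assms])
  then consider "a = p \<and> b = p + u" | "b = p \<and> a = p + u" | "a = p \<and> b = p + v" | "b = p \<and> a = p + v"
    | "a = p + u \<and> b = p + u + v" | "b = p + u \<and> a = p + u + v"
    | "a = p + v \<and> b = p + u + v" | "b = p + v \<and> a = p + u + v"
    unfolding insert_iff empty_iff doubleton_eq_iff by argo
  then show ?thesis by cases simp_all
qed

text \<open>
  A rhombus may be described starting from any of its corners and in either order of its sides;
  this puts a prescribed edge first.
\<close>

lemma unit_rhombus_edge_normal_form:
  assumes R: "unit_rhombus R" and e: "closed_segment a b edge_of R"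
  obtains v where "rhombus_sides (b - a) v" "R = rhomb a (b - a) v"
proof -
  obtain p u v where sides: "rhombus_sides u v" and Rp: "R = rhomb p u v"
    using R unit_rhombus_iff by blast
  have "{a, b} \<in> {{p, p + u}, {p, p + v}, {p + u, p + u + v}, {p + v, p + u + v}}"
    using rhomb_edge_cases[OF sides] e Rp by blast
  then consider "a = p \<and> b = p + u \<or> b = p \<and> a = p + u" | "a = p \<and> b = p + v \<or> b = p \<and> a = p + v"
    | "a = p + u \<and> b = p + u + v \<or> b = p + u \<and> a = p + u + v"
    | "a = p + v \<and> b = p + u + v \<or> b = p + v \<and> a = p + u + v"
    unfolding insert_iff empty_iff doubleton_eq_iff by blast
  note cases = this
  have s1: "rhombus_sides u (- v)" "rhombus_sides v (- u)"
    using sides rhombus_sides_swap rhombus_sides_neg by blast+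
  have s2: "rhombus_sides (- u) v" "rhombus_sides (- v) u" "rhombus_sides (- u) (- v)" "rhombus_sides (- v) (- u)" "rhombus_sides v u"
    using sides rhombus_sides_swap rhombus_sides_neg by blast+
  have R': "R = rhomb p v u" "R = rhomb (p + u) (- u) v" "R = rhomb (p + v) (- v) u"
    "R = rhomb (p + u) v (- u)" "R = rhomb (p + v) u (- v)"
    "R = rhomb (p + u + v) (- u) (- v)" "R = rhomb (p + u + v) (- v) (- u)"
    unfolding Rp by (metis rhomb_swap rhomb_shift add.commute add.assoc)+
  from cases show thesis
  proof cases
    case 1 then show thesis using that[of v] sides s2 Rp R' by (auto simp: algebra_simps)
  next
    case 2 then show thesis using that[of u] sides s2 Rp R' by (auto simp: algebra_simps)
  next
    case 3 then show thesis using that[of "- u"] s1 s2 Rp R' by (auto simp: algebra_simps)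
  next
    case 4 then show thesis using that[of "- v"] s1 s2 Rp R' by (auto simp: algebra_simps)
  qed
qed

lemma rhombus_sides_1:
  assumes "rhombus_sides 1 v"
  shows "Im v \<noteq> 0" "\<bar>Re v\<bar> \<le> 1" "\<bar>Im v\<bar> \<le> 1" "v \<noteq> 1" "v \<noteq> - 1" "v \<noteq> 0"
  using assms rhombus_sides_independent[OF assms] abs_Re_le_cmod[of v] abs_Im_le_cmod[of v]
  by (auto simp: rhombus_sides_def)

text \<open>
  Just above or just below (according to the sign of \<open>Im v\<close>) the midpoint of a horizontal side
  lies the interior of the rhombus, so two tiles on the same side of a horizontal edge overlap.
\<close>

lemma rhomb_1_near_side:
  assumes v: "rhombus_sides 1 v" and t: "0 < t" "t \<le> 1 / 4"
  shows "p + 1 / 2 + \<i> * of_real (t * Im v) \<in> interior (rhomb p 1 v)"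
proof -
  have "\<bar>t * Re v\<bar> \<le> 1 / 4 * 1"
    unfolding abs_mult using t rhombus_sides_1(2)[OF v] by (intro mult_mono) auto
  then have "p + of_real (1 / 2 - t * Re v) * 1 + of_real t * v \<in> interior (rhomb p 1 v)"
    using t by (intro rhomb_interiorI[OF v]) (auto simp: abs_le_iff)
  also have "p + of_real (1 / 2 - t * Re v) * 1 + of_real t * v = p + 1 / 2 + \<i> * of_real (t * Im v)"
    by (simp add: complex_eq_iff)
  finally show ?thesis .
qed

lemma unit_rhombus_closed: "unit_rhombus R \<Longrightarrow> closed R"
  using compact_rhomb compact_imp_closed unit_rhombus_iff by metis

lemma unit_rhombus_compact: "unit_rhombus R \<Longrightarrow> compact R"
  using compact_rhomb unit_rhombus_iff by metis

lemma unit_rhombus_convex: "unit_rhombus R \<Longrightarrow> convex R"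
  using convex_rhomb unit_rhombus_iff by metis

lemma unit_rhombus_diameter:
  assumes "unit_rhombus R" "x \<in> R" "y \<in> R"
  shows "dist x y \<le> 2"
proof -
  obtain p u v where sides: "rhombus_sides u v" and R: "R = rhomb p u v"
    using assms(1) unit_rhombus_iff by blast
  obtain s t where x: "x = p + of_real s * u + of_real t * v" "0 \<le> s" "s \<le> 1" "0 \<le> t" "t \<le> 1"
    using assms(2) R rhomb_memE by blast
  obtain s' t' where y: "y = p + of_real s' * u + of_real t' * v" "0 \<le> s'" "s' \<le> 1" "0 \<le> t'" "t' \<le> 1"
    using assms(3) R rhomb_memE by blast
  have "x - y = of_real (s - s') * u + of_real (t - t') * v"
    unfolding x y by (simp add: algebra_simps)
  then have "dist x y \<le> norm (of_real (s - s') * u) + norm (of_real (t - t') * v)"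
    by (simp add: dist_norm norm_triangle_ineq)
  also have "\<dots> = \<bar>s - s'\<bar> + \<bar>t - t'\<bar>"
    using sides unfolding rhombus_sides_def norm_mult norm_of_real by simp
  finally show ?thesis using x y by linarith
qed

section \<open>Additive cocycles on a convex cover of the plane\<close>

text \<open>
  The assumption \<open>star\<close> is local finiteness in the form in which it is used: near \<open>x\<close> only
  members through \<open>x\<close> are seen.
\<close>

locale star_cover =
  fixes T :: "complex set set"
  assumes cover: "\<exists>R\<in>T. x \<in> R"
    and closed_member: "R \<in> T \<Longrightarrow> closed R"
    and convex_member: "R \<in> T \<Longrightarrow> convex R"
    and star: "\<exists>e>0. \<forall>R\<in>T. R \<inter> ball x e \<noteq> {} \<longrightarrow> x \<in> R"
begin

text \<open>
  The value of \<open>a\<close> on the members through a point of \<open>X\<close> is a locally constant function on \<open>X\<close>.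
\<close>

lemma constant_of_overlaps:
  assumes X: "connected X"
    and a: "\<And>R S. R \<in> T \<Longrightarrow> S \<in> T \<Longrightarrow> R \<inter> S \<inter> X \<noteq> {} \<Longrightarrow> a R = a S"
    and RS: "R \<in> T" "S \<in> T" "R \<inter> X \<noteq> {}" "S \<inter> X \<noteq> {}"
  shows "a R = a S"
proof -
  define f where "f x = a (SOME R. R \<in> T \<and> x \<in> R)" for x
  have f: "f x = a R" if "x \<in> X" "x \<in> R" "R \<in> T" for x R
  proof -
    have "(SOME R. R \<in> T \<and> x \<in> R) \<in> T \<and> x \<in> (SOME R. R \<in> T \<and> x \<in> R)"
      by (rule someI[of _ R]) (use that in blast)
    then show ?thesis unfolding f_def using a that by blast
  qed
  obtain x y where xy: "x \<in> R" "x \<in> X" "y \<in> S" "y \<in> X" using RS by blast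
  have "f x = f y"
  proof (rule connected_local_const[OF X])
    show "\<forall>z\<in>X. eventually (\<lambda>w. f z = f w) (at z within X)"
    proof
      fix z assume z: "z \<in> X"
      obtain e where e: "e > 0" "\<forall>R\<in>T. R \<inter> ball z e \<noteq> {} \<longrightarrow> z \<in> R" using star by blast
      have "f z = f w" if w: "w \<in> X" "dist w z < e" for w
      proof -
        obtain Q where Q: "Q \<in> T" "w \<in> Q" using cover by blast
        then have "Q \<inter> ball z e \<noteq> {}" using w by (auto simp: dist_commute)
        then have "z \<in> Q" using e Q by blast
        then show ?thesis using f Q z w by simp
      qed
      then show "eventually (\<lambda>w. f z = f w) (at z within X)"
        unfolding eventually_at using e(1) by blast
    qed
  qed (use xy in auto)
  then show ?thesis using f xy RS by simp
qed

end

locale star_cover_cocycle = star_cover +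
  fixes c :: "complex set \<Rightarrow> complex set \<Rightarrow> 'v::ab_group_add"
  assumes cocycle:
    "R \<in> T \<Longrightarrow> S \<in> T \<Longrightarrow> Q \<in> T \<Longrightarrow> R \<inter> S \<inter> Q \<noteq> {} \<Longrightarrow> c R S + c S Q = c R Q"
begin

text \<open>
  Only intersections inside \<open>X\<close> count, so a splitting on \<open>X\<close> is a section of a torsor over \<open>X\<close>.
\<close>

definition splits_on :: "complex set \<Rightarrow> (complex set \<Rightarrow> 'v) \<Rightarrow> bool" where
  "splits_on X s \<longleftrightarrow> (\<forall>R\<in>T. \<forall>S\<in>T. R \<inter> S \<inter> X \<noteq> {} \<longrightarrow> s R - s S = c R S)"

lemma splits_on_subset: "splits_on Y s \<Longrightarrow> X \<subseteq> Y \<Longrightarrow> splits_on X s"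
  unfolding splits_on_def by blast

lemma splits_on_unique:
  assumes "connected X" "splits_on X s" "splits_on X t"
    and "R \<in> T" "S \<in> T" "R \<inter> X \<noteq> {}" "S \<inter> X \<noteq> {}"
  shows "s R - t R = s S - t S"
proof (rule constant_of_overlaps[OF assms(1), where a = "\<lambda>R. s R - t R"])
  fix R S assume "R \<in> T" "S \<in> T" "R \<inter> S \<inter> X \<noteq> {}"
  then have "s R - s S = t R - t S" using assms(2,3) unfolding splits_on_def by metis
  then show "s R - t R = s S - t S" by (simp add: algebra_simps)
qed (use assms in auto)

text \<open>
  On the connected overlap the two splittings differ by a constant, by which the second one is
  shifted. Convexity of the union is needed for a member meeting both \<open>X\<close> and \<open>Y\<close>: it then meets
  the overlap, so the two prescriptions for its value agree.
\<close>

lemma splits_on_union: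
  assumes XY: "closed X" "closed Y" "convex (X \<union> Y)" "connected (X \<inter> Y)"
    and s: "splits_on X s" and t: "splits_on Y t"
  shows "\<exists>w. splits_on (X \<union> Y) w"
proof -
  have "splits_on (X \<inter> Y) s" "splits_on (X \<inter> Y) t"
    using s t splits_on_subset by blast+
  then have "s R - t R = s S - t S"
    if "R \<in> T" "S \<in> T" "R \<inter> (X \<inter> Y) \<noteq> {}" "S \<inter> (X \<inter> Y) \<noteq> {}" for R S
    using splits_on_unique[OF XY(4)] that by blast
  then obtain k where k: "\<And>R. R \<in> T \<Longrightarrow> R \<inter> (X \<inter> Y) \<noteq> {} \<Longrightarrow> s R - t R = k"
    by metis
  define w where "w R = (if R \<inter> X \<noteq> {} then s R else t R + k)" for R
  have wY: "w R = t R + k" if R: "R \<in> T" "R \<inter> Y \<noteq> {}" for R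
  proof (cases "R \<inter> X = {}")
    case False
    \<comment> \<open>The convex set \<open>R \<inter> (X \<union> Y)\<close> cannot be the disjoint union of two closed pieces.\<close>
    have "connected (R \<inter> (X \<union> Y))"
      using convex_member[OF R(1)] XY(3) by (intro convex_connected convex_Int)
    then have "R \<inter> (X \<inter> Y) \<noteq> {}"
      using connected_closedD[of "R \<inter> (X \<union> Y)" "R \<inter> X" "R \<inter> Y"]
        closed_member[OF R(1)] XY(1,2) False R(2) by blast
    then have "s R - t R = k" using k R by blast
    then show ?thesis using False by (simp add: w_def algebra_simps)
  qed (simp add: w_def)
  have "w R - w S = c R S" if "R \<in> T" "S \<in> T" "R \<inter> S \<inter> (X \<union> Y) \<noteq> {}" for R S
  proof (cases "R \<inter> S \<inter> X = {}")
    case True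
    then have ne: "R \<inter> S \<inter> Y \<noteq> {}" using that by blast
    then have "w R = t R + k" "w S = t S + k" using wY that by blast+
    then show ?thesis using t ne that unfolding splits_on_def by simp
  next
    case False
    then have "w R = s R" "w S = s S" by (auto simp: w_def)
    then show ?thesis using s False that unfolding splits_on_def by simp
  qed
  then show ?thesis unfolding splits_on_def by blast
qed

definition rect :: "real \<Rightarrow> real \<Rightarrow> real \<Rightarrow> real \<Rightarrow> complex set" where
  "rect a b a' b' = Re -` {a..b} \<inter> Im -` {a'..b'}"

lemma closed_rect: "closed (rect a b a' b')"
  unfolding rect_def by (intro closed_Int continuous_closed_vimage) (auto intro: continuous_intros)

lemma convex_rect: "convex (rect a b a' b')"
  unfolding rect_def
  by (intro convex_Int convex_linear_vimage bounded_linear.linear bounded_linear_Re bounded_linear_Im)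
    auto

lemma splits_on_rect_union:
  assumes "splits_on (rect a b a' b') s" "splits_on (rect b d a' b') t" "a \<le> b" "b \<le> d"
  shows "\<exists>w. splits_on (rect a d a' b') w"
proof -
  have "rect a b a' b' \<union> rect b d a' b' = rect a d a' b'" using assms(3,4) by (auto simp: rect_def)
  moreover have "rect a b a' b' \<inter> rect b d a' b' = rect b b a' b'"
    using assms(3,4) by (auto simp: rect_def)
  ultimately show ?thesis
    using splits_on_union[OF closed_rect closed_rect _ _ assms(1,2)] convex_rect convex_connected
    by metis
qed

lemma splits_on_rect_union':
  assumes "splits_on (rect a b a' b') s" "splits_on (rect a b b' d') t" "a' \<le> b'" "b' \<le> d'"
  shows "\<exists>w. splits_on (rect a b a' d') w"
proof -
  have "rect a b a' b' \<union> rect a b b' d' = rect a b a' d'" using assms(3,4) by (auto simp: rect_def)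
  moreover have "rect a b a' b' \<inter> rect a b b' d' = rect a b b' b'"
    using assms(3,4) by (auto simp: rect_def)
  ultimately show ?thesis
    using splits_on_union[OF closed_rect closed_rect _ _ assms(1,2)] convex_rect convex_connected
    by metis
qed

text \<open>
  All members that meet a small neighbourhood of a point share the point, and on members with a
  common point the cocycle is split by comparison with a fixed one of them.
\<close>

lemma splits_on_small_rect:
  "\<exists>d>0. \<forall>a b a' b'. a \<le> x \<and> x \<le> b \<and> a' \<le> y \<and> y \<le> b' \<and> b - a < d \<and> b' - a' < d \<longrightarrow>
     (\<exists>s. splits_on (rect a b a' b') s)"
proof -
  obtain e where e: "e > 0" "\<forall>R\<in>T. R \<inter> ball (Complex x y) e \<noteq> {} \<longrightarrow> Complex x y \<in> R"
    using star by blast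
  obtain Q where Q: "Q \<in> T" "Complex x y \<in> Q" using cover by blast
  have "splits_on (rect a b a' b') (\<lambda>R. c R Q)"
    if ab: "a \<le> x" "x \<le> b" "a' \<le> y" "y \<le> b'" "b - a < e / 2" "b' - a' < e / 2" for a b a' b'
  proof -
    have sub: "rect a b a' b' \<subseteq> ball (Complex x y) e"
    proof
      fix z assume "z \<in> rect a b a' b'"
      then have "a \<le> Re z" "Re z \<le> b" "a' \<le> Im z" "Im z \<le> b'" by (auto simp: rect_def)
      then have "\<bar>x - Re z\<bar> < e / 2" "\<bar>y - Im z\<bar> < e / 2" using ab by linarith+
      then have "cmod (Complex x y - z) < e" using cmod_le[of "Complex x y - z"] by simp
      then show "z \<in> ball (Complex x y) e" by (simp add: dist_norm)
    qed
    show ?thesis unfolding splits_on_def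
    proof (intro ballI impI)
      fix R S assume RS: "R \<in> T" "S \<in> T" "R \<inter> S \<inter> rect a b a' b' \<noteq> {}"
      then have "Complex x y \<in> R" "Complex x y \<in> S" using e sub by blast+
      then have "c R S + c S Q = c R Q" using cocycle RS Q by blast
      then show "c R Q - c S Q = c R S" by (simp add: algebra_simps)
    qed
  qed
  then show ?thesis using half_gt_zero[OF e(1)] by blast
qed

text \<open>
  Bisection in both directions: the inner induction produces, around each abscissa, thin
  vertical rectangles of the full height; the outer one joins them.
\<close>

lemma splits_on_rect:
  assumes "a \<le> b" "a' \<le> b'"
  shows "\<exists>s. splits_on (rect a b a' b') s"
  using assms(1)
proof (induction rule: Bolzano)
  case (trans a b c)
  then show ?case using splits_on_rect_union by blast
next
  case (local x)
  show ?case using assms(2)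
  proof (induction rule: Bolzano)
    case (trans l m n)
    then obtain d1 d2 where "d1 > 0" "d2 > 0"
      and "\<forall>a b. a \<le> x \<and> x \<le> b \<and> b - a < d1 \<longrightarrow> (\<exists>s. splits_on (rect a b l m) s)"
      and "\<forall>a b. a \<le> x \<and> x \<le> b \<and> b - a < d2 \<longrightarrow> (\<exists>s. splits_on (rect a b m n) s)" by blast
    then show ?case using trans(3,4) splits_on_rect_union'
      by (intro exI[of _ "min d1 d2"]) (metis min_less_iff_conj)
  next
    case (local y)
    obtain d where d: "d > 0" "\<And>a b a' b'. a \<le> x \<and> x \<le> b \<and> a' \<le> y \<and> y \<le> b' \<and> b - a < d \<and> b' - a' < d \<Longrightarrow>
       (\<exists>s. splits_on (rect a b a' b') s)" using splits_on_small_rect by blast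
    show ?case
    proof (rule exI[of _ d], intro conjI allI impI)
      fix a' b' assume "a' \<le> y \<and> y \<le> b' \<and> b' - a' < d"
      then show "\<exists>da>0. \<forall>a b. a \<le> x \<and> x \<le> b \<and> b - a < da \<longrightarrow> (\<exists>s. splits_on (rect a b a' b') s)"
        using d by (intro exI[of _ d]) blast
    qed (rule d)
  qed
qed

text \<open>
  The splittings on an exhausting sequence of squares are normalised to vanish on a member
  through \<open>0\<close>; by uniqueness on connected sets they then extend one another.
\<close>

lemma cocycle_splits:
  obtains s where "\<And>R S. R \<in> T \<Longrightarrow> S \<in> T \<Longrightarrow> R \<inter> S \<noteq> {} \<Longrightarrow> s R - s S = c R S"
proof -
  define B where "B n = rect (- real n) (real n) (- real n) (real n)" for n :: nat
  have conB: "connected (B n)" for n unfolding B_def by (intro convex_connected convex_rect)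
  have mono: "B m \<subseteq> B n" if "m \<le> n" for m n using that by (auto simp: B_def rect_def)
  have in_B: "\<exists>n. x \<in> B n" for x
  proof -
    obtain n where "\<bar>Re x\<bar> + \<bar>Im x\<bar> \<le> real n" using real_arch_simple by blast
    then have "x \<in> B n" by (auto simp: B_def rect_def)
    then show ?thesis ..
  qed
  obtain Q where Q: "Q \<in> T" "0 \<in> Q" using cover by blast
  have QB: "Q \<inter> B n \<noteq> {}" for n using Q by (auto simp: B_def rect_def)
  have "\<exists>s. splits_on (B n) s \<and> s Q = 0" for n
  proof -
    obtain s where "splits_on (B n) s" unfolding B_def using splits_on_rect[of "- real n" "real n" "- real n" "real n"] by auto
    then have "splits_on (B n) (\<lambda>R. s R - s Q)" unfolding splits_on_def by simp
    then show ?thesis by (intro exI[of _ "\<lambda>R. s R - s Q"]) simp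
  qed
  then obtain s where s: "\<And>n. splits_on (B n) (s n)" "\<And>n. s n Q = 0" by metis
  have agree: "s m R = s n R" if "R \<in> T" "R \<inter> B m \<noteq> {}" "m \<le> n" for R m n
    using splits_on_unique[OF conB s(1)[of m] splits_on_subset[OF s(1)[of n] mono[OF that(3)]] that(1) Q(1) that(2) QB]
    by (simp add: s(2))
  define w where "w R = s (LEAST n. R \<inter> B n \<noteq> {}) R" for R
  have w: "w R = s n R" if "R \<in> T" "R \<inter> B n \<noteq> {}" for R n
    unfolding w_def using agree[OF that(1)] LeastI[of "\<lambda>n. R \<inter> B n \<noteq> {}", OF that(2)]
      Least_le[of "\<lambda>n. R \<inter> B n \<noteq> {}", OF that(2)] by blast
  show thesis
  proof (rule that[of w])
    fix R S assume RS: "R \<in> T" "S \<in> T" "R \<inter> S \<noteq> {}"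
    then obtain x n where "x \<in> R" "x \<in> S" "x \<in> B n" using in_B by blast
    then have "R \<inter> S \<inter> B n \<noteq> {}" "R \<inter> B n \<noteq> {}" "S \<inter> B n \<noteq> {}" by blast+
    then show "w R - w S = c R S"
      using w[of R n] w[of S n] s(1)[of n] RS unfolding splits_on_def by simp
  qed
qed

end

context star_cover
begin

text \<open>
  Functions given on the members of the cover and differing by constants on overlaps can be made
  to agree by adding constants. The set \<open>D\<close> allows for functions that matter only at the
  vertices of a tiling.
\<close>

lemma glue_potentials:
  fixes f :: "complex set \<Rightarrow> complex \<Rightarrow> 'v::ab_group_add"
  assumes const: "\<And>R S x y. R \<in> T \<Longrightarrow> S \<in> T \<Longrightarrow> x \<in> R \<inter> S \<inter> D \<Longrightarrow> y \<in> R \<inter> S \<inter> D \<Longrightarrow>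
      f S x - f R x = f S y - f R y"
    and meets: "\<And>R S Q. R \<in> T \<Longrightarrow> S \<in> T \<Longrightarrow> Q \<in> T \<Longrightarrow> R \<inter> S \<inter> Q \<noteq> {} \<Longrightarrow> R \<inter> S \<inter> Q \<inter> D \<noteq> {}"
  obtains F k where "\<And>R x. R \<in> T \<Longrightarrow> x \<in> R \<inter> D \<Longrightarrow> F x = f R x + k R"
proof -
  define c where "c R S = (let x = SOME x. x \<in> R \<inter> S \<inter> D in f S x - f R x)" for R S
  have c: "c R S = f S x - f R x" if "R \<in> T" "S \<in> T" "x \<in> R \<inter> S \<inter> D" for R S x
  proof -
    have "(SOME x. x \<in> R \<inter> S \<inter> D) \<in> R \<inter> S \<inter> D" using someI[of "\<lambda>x. x \<in> R \<inter> S \<inter> D"] that by blast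
    then show ?thesis unfolding c_def Let_def using const[OF that(1,2) _ that(3)] by blast
  qed
  interpret star_cover_cocycle T c
  proof
    fix R S Q assume RSQ: "R \<in> T" "S \<in> T" "Q \<in> T" "R \<inter> S \<inter> Q \<noteq> {}"
    then obtain x where "x \<in> R \<inter> S \<inter> Q \<inter> D" using meets by blast
    then have "c R S = f S x - f R x" "c S Q = f Q x - f S x" "c R Q = f Q x - f R x"
      using c RSQ by blast+
    then show "c R S + c S Q = c R Q" by simp
  qed
  obtain k where k: "\<And>R S. R \<in> T \<Longrightarrow> S \<in> T \<Longrightarrow> R \<inter> S \<noteq> {} \<Longrightarrow> k R - k S = c R S"
    using cocycle_splits by blast
  define F where "F x = (let R = SOME R. R \<in> T \<and> x \<in> R in f R x + k R)" for x
  have "F x = f R x + k R" if "R \<in> T" "x \<in> R \<inter> D" for R x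
  proof -
    define S where "S = (SOME R. R \<in> T \<and> x \<in> R)"
    have S: "S \<in> T" "x \<in> S" using someI_ex[of "\<lambda>R. R \<in> T \<and> x \<in> R"] that unfolding S_def by blast+
    then have "k S - k R = f R x - f S x" using k[of S R] c[of S R x] that by auto
    then show ?thesis unfolding F_def Let_def S_def[symmetric] by (simp add: algebra_simps)
  qed
  then show thesis by (rule that)
qed

end

section \<open>Edge functions on a rhombic tiling\<close>

locale rhombic_tiling =
  fixes \<Lambda> :: "complex set set"
  assumes lattice: "rhombic_lattice \<Lambda>"
begin

lemma tile_rhombus: "R \<in> \<Lambda> \<Longrightarrow> unit_rhombus R"
  using lattice by (simp add: rhombic_lattice_def)

lemma tile_exists: "\<exists>R\<in>\<Lambda>. x \<in> R"
  using lattice by (auto simp: rhombic_lattice_def)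

lemma tile_eqI: "R \<in> \<Lambda> \<Longrightarrow> S \<in> \<Lambda> \<Longrightarrow> x \<in> interior R \<Longrightarrow> x \<in> interior S \<Longrightarrow> R = S"
  using lattice unfolding rhombic_lattice_def by blast

lemma tile_Int_face: "R \<in> \<Lambda> \<Longrightarrow> S \<in> \<Lambda> \<Longrightarrow> (R \<inter> S) face_of R"
  using lattice unfolding rhombic_lattice_def
  by (cases "R = S") (auto intro: face_of_refl unit_rhombus_convex)

text \<open>
  This is where congruence of the tiles enters: it gives both local finiteness of the tiling and
  a lower bound for the height of the tiles with a horizontal edge.
\<close>

lemma tile_inradius:
  obtains r where "r > 0" "\<And>R. R \<in> \<Lambda> \<Longrightarrow> \<exists>c. ball c r \<subseteq> R"
proof -
  obtain R where R: "R \<in> \<Lambda>" using tile_exists by blast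
  then have "interior R \<noteq> {}" using tile_rhombus rhomb_nonempty_interior unit_rhombus_iff by metis
  then obtain c r where cr: "r > 0" "ball c r \<subseteq> R" using mem_interior by blast
  have "\<exists>c'. ball c' r \<subseteq> S" if "S \<in> \<Lambda>" for S
  proof -
    have "congruent_sets R S" using lattice R that by (simp add: rhombic_lattice_def)
    then obtain d h where h: "orthogonal_transformation h" "S = (\<lambda>x. d + h x) ` R"
      unfolding congruent_sets_def by blast
    have "ball (d + h c) r \<subseteq> S"
    proof
      fix y assume "y \<in> ball (d + h c) r"
      then have "y - d \<in> ball (h c) r" by (simp add: dist_norm algebra_simps)
      then have "y - d \<in> h ` ball c r" by (simp add: image_orthogonal_transformation_ball[OF h(1)])
      then obtain x where "x \<in> ball c r" "y - d = h x" by blast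
      then have "y = d + h x" "x \<in> R" using cr by (auto simp: algebra_simps)
      then show "y \<in> S" using h(2) by blast
    qed
    then show ?thesis ..
  qed
  with cr(1) show thesis by (rule that)
qed

text \<open>
  The inscribed balls of distinct tiles are disjoint, so their centres form a uniformly discrete
  set.
\<close>

lemma finite_tiles_near: "finite {R \<in> \<Lambda>. R \<inter> ball x 1 \<noteq> {}}"
proof -
  let ?A = "{R \<in> \<Lambda>. R \<inter> ball x 1 \<noteq> {}}"
  obtain r where r: "r > 0" "\<And>R. R \<in> \<Lambda> \<Longrightarrow> \<exists>c. ball c r \<subseteq> R" using tile_inradius by blast
  then obtain c where c: "\<And>R. R \<in> \<Lambda> \<Longrightarrow> ball (c R) r \<subseteq> R" by metis
  have near: "R = S" if "R \<in> \<Lambda>" "S \<in> \<Lambda>" "dist (c R) (c S) < r" for R S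
  proof (rule tile_eqI[OF that(1,2)])
    have "ball (c R) r \<subseteq> interior R" "ball (c S) r \<subseteq> interior S"
      using c that by (simp_all add: interior_maximal)
    moreover have "c S \<in> ball (c R) r" "c S \<in> ball (c S) r" using that(3) r(1) by simp_all
    ultimately show "c S \<in> interior R" "c S \<in> interior S" by blast+
  qed
  have "inj_on c ?A"
  proof (rule inj_onI)
    fix R S assume "R \<in> ?A" "S \<in> ?A" "c R = c S"
    then show "R = S" using near[of R S] r(1) by simp
  qed
  moreover have "uniform_discrete (c ` ?A)"
    unfolding uniform_discrete_def using near r(1) by blast
  moreover have "bounded (c ` ?A)"
  proof -
    have "c R \<in> ball x 4" if "R \<in> ?A" for R
    proof -
      obtain y where y: "y \<in> R" "y \<in> ball x 1" using \<open>R \<in> ?A\<close> by blast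
      have "c R \<in> R" using that c r(1) by (metis (no_types, lifting) centre_in_ball mem_Collect_eq subsetD)
      then have "dist y (c R) \<le> 2" using unit_rhombus_diameter tile_rhombus y that by blast
      then show ?thesis using y(2) dist_triangle[of x "c R" y] by simp
    qed
    then show ?thesis by (meson bounded_ball bounded_subset image_subsetI)
  qed
  ultimately show ?thesis using uniform_discrete_finite_iff finite_imageD by blast
qed

sublocale star_cover \<Lambda>
proof
  fix x R
  show "\<exists>R\<in>\<Lambda>. x \<in> R" by (rule tile_exists)
  show "closed R" "convex R" if "R \<in> \<Lambda>"
    using that tile_rhombus unit_rhombus_closed unit_rhombus_convex by blast+
  let ?B = "{R \<in> \<Lambda>. R \<inter> ball x 1 \<noteq> {} \<and> x \<notin> R}"
  have "finite ?B" using finite_tiles_near[of x] by (rule rev_finite_subset) auto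
  then have "closed (\<Union>?B)" using tile_rhombus unit_rhombus_closed by (intro closed_Union) auto
  then have "open (- \<Union>?B)" by (rule open_Compl)
  moreover have "x \<in> - \<Union>?B" by blast
  ultimately obtain e where e: "e > 0" "ball x e \<subseteq> - \<Union>?B" by (meson openE)
  have "x \<in> R" if "R \<in> \<Lambda>" "R \<inter> ball x (min e 1) \<noteq> {}" for R
  proof -
    have "\<exists>y\<in>R. y \<in> ball x e \<and> y \<in> ball x 1" using that(2) by (auto simp: disjoint_iff)
    then show ?thesis using e(2) that(1) by blast
  qed
  then show "\<exists>e>0. \<forall>R\<in>\<Lambda>. R \<inter> ball x e \<noteq> {} \<longrightarrow> x \<in> R"
    using e(1) by (intro exI[of _ "min e 1"]) auto
qed

lemma vert_extreme_point:
  assumes "x \<in> verts \<Lambda>" "x \<in> R" "R \<in> \<Lambda>"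
  shows "x extreme_point_of R"
proof -
  obtain S where S: "S \<in> \<Lambda>" "x extreme_point_of S" using assms(1) by (auto simp: verts_def)
  then have "x \<in> R \<inter> S" using assms(2) by (auto simp: extreme_point_of_def)
  then have "x extreme_point_of R \<inter> S"
    using extreme_point_of_face[OF tile_Int_face[OF S(1) assms(3)]] S(2) by (simp add: Int_commute)
  then show ?thesis using extreme_point_of_face[OF tile_Int_face[OF assms(3) S(1)]] by blast
qed

lemma vert_corner:
  assumes "x \<in> verts \<Lambda>" "x \<in> rhomb p u v" "rhomb p u v \<in> \<Lambda>" "rhombus_sides u v"
  shows "x \<in> {p, p + u, p + u + v, p + v}"
  using vert_extreme_point[OF assms(1,2,3)] rhomb_extreme_points[OF assms(4)] by blast

text \<open>
  An intersection of tiles is a compact face of each, and its extreme points are vertices. Thus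
  it suffices to compare functions on tiles at vertices.
\<close>

lemma tiles_Int_vert:
  assumes "R \<in> \<Lambda>" "S \<in> \<Lambda>" "Q \<in> \<Lambda>" "R \<inter> S \<inter> Q \<noteq> {}"
  shows "R \<inter> S \<inter> Q \<inter> verts \<Lambda> \<noteq> {}"
proof -
  have f: "(R \<inter> S \<inter> (R \<inter> Q)) face_of R" using assms by (intro face_of_Int tile_Int_face)
  moreover have "R \<inter> S \<inter> (R \<inter> Q) = R \<inter> S \<inter> Q" by blast
  ultimately have f: "(R \<inter> S \<inter> Q) face_of R" by simp
  have R: "convex R" "compact R" using assms(1) tile_rhombus unit_rhombus_convex unit_rhombus_compact by blast+
  have "compact (R \<inter> S \<inter> Q)" "convex (R \<inter> S \<inter> Q)"
    using face_of_imp_compact[OF R f] face_of_imp_convex[OF f] .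
  then obtain x where x: "x extreme_point_of (R \<inter> S \<inter> Q)"
    using extreme_point_exists_convex assms(4) by blast
  then have "x extreme_point_of R" "x \<in> R \<inter> S \<inter> Q" using extreme_point_of_face[OF f] by blast+
  then show ?thesis using assms(1) unfolding verts_def by blast
qed

text \<open>
  Edge-to-edgeness: the only proper faces of a tile with more than one point are its sides.
\<close>

lemma tiles_Int_edge:
  assumes RS: "R \<in> \<Lambda>" "S \<in> \<Lambda>" "R \<noteq> S" and xy: "x \<in> R \<inter> S" "y \<in> R \<inter> S" "x \<noteq> y"
  obtains a b where "R \<inter> S = closed_segment a b" "closed_segment a b edge_of R"
    "closed_segment a b edge_of S"
proof -
  obtain p u v where sides: "rhombus_sides u v" and R: "R = rhomb p u v"
    using RS(1) tile_rhombus unit_rhombus_iff by blast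
  have f: "(R \<inter> S) face_of R" using RS by (intro tile_Int_face)
  have g: "(R \<inter> S) face_of S" using tile_Int_face[OF RS(2,1)] by (simp add: Int_commute)
  have ne: "R \<inter> S \<noteq> R"
  proof
    assume "R \<inter> S = R"
    then have "interior R \<subseteq> interior S" by (intro interior_mono) auto
    then show False using RS tile_eqI rhomb_nonempty_interior[OF sides] R by blast
  qed
  have "R \<inter> S \<noteq> {a}" for a using xy by (metis singletonD)
  moreover have "R \<inter> S \<noteq> {}" using xy(1) by blast
  ultimately have "R \<inter> S \<in> {closed_segment p (p + u), closed_segment p (p + v),
      closed_segment (p + u) (p + u + v), closed_segment (p + v) (p + u + v)}"
    using rhomb_proper_face[OF sides f[unfolded R]] ne unfolding R by blast
  then obtain a b where ab: "R \<inter> S = closed_segment a b" "closed_segment a b edge_of R"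
    using rhomb_side_edges[OF sides, of p] unfolding R[symmetric] insert_iff empty_iff by blast
  moreover have "closed_segment a b edge_of S"
    using g ab unfolding edge_of_def by simp
  ultimately show thesis by (rule that)
qed

lemma shared_edge:
  assumes RS: "R \<in> \<Lambda>" "S \<in> \<Lambda>" "R \<noteq> S"
    and xy: "x \<in> R \<inter> S" "y \<in> R \<inter> S" "x \<in> verts \<Lambda>" "y \<in> verts \<Lambda>" "x \<noteq> y"
  shows "closed_segment x y edge_of R" "closed_segment x y edge_of S"
proof -
  obtain a b where ab: "R \<inter> S = closed_segment a b" "closed_segment a b edge_of R"
    "closed_segment a b edge_of S"
    using tiles_Int_edge[OF RS xy(1,2,5)] .
  have "x extreme_point_of R \<inter> S" "y extreme_point_of R \<inter> S"
    using extreme_point_of_face[OF tile_Int_face[OF RS(1,2)]] vert_extreme_point xy RS by blast+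
  then have "x \<in> {a, b}" "y \<in> {a, b}" using ab by (simp_all add: extreme_point_of_segment)
  then have eq: "closed_segment a b = closed_segment x y" using xy(5) by (auto simp: doubleton_eq_iff)
  show "closed_segment x y edge_of R" "closed_segment x y edge_of S" using ab(2,3) unfolding eq .
qed

lemma edge_ends:
  assumes "closed_segment a b edge_of R"
  shows "a extreme_point_of R" "b extreme_point_of R"
  using assms extreme_point_of_face extreme_point_of_segment unfolding edge_of_def by blast+

lemma adjacent_iff: "adjacent \<Lambda> a b \<longleftrightarrow> (\<exists>R\<in>\<Lambda>. closed_segment a b edge_of R)"
  unfolding adjacent_def verts_def using edge_ends by blast

lemma adjacent_sym: "adjacent \<Lambda> a b \<Longrightarrow> adjacent \<Lambda> b a"
  unfolding adjacent_def by (metis closed_segment_commute)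

lemma adjacent_tile:
  assumes "adjacent \<Lambda> a b"
  obtains v where "rhombus_sides (b - a) v" "rhomb a (b - a) v \<in> \<Lambda>"
  using assms tile_rhombus unit_rhombus_edge_normal_form unfolding adjacent_iff by metis

lemma rhomb_adjacent:
  assumes "rhomb p u v \<in> \<Lambda>" "rhombus_sides u v"
  shows "adjacent \<Lambda> p (p + u)" "adjacent \<Lambda> p (p + v)"
    "adjacent \<Lambda> (p + u) (p + u + v)" "adjacent \<Lambda> (p + v) (p + u + v)"
  using rhomb_side_edges[OF assms(2)] assms(1) unfolding adjacent_iff by blast+

lemma adjacent_norm: "adjacent \<Lambda> a b \<Longrightarrow> norm (b - a) = 1"
  by (metis adjacent_tile rhombus_sides_def)

lemma adjacent_verts: "adjacent \<Lambda> a b \<Longrightarrow> a \<in> verts \<Lambda> \<and> b \<in> verts \<Lambda>"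
  by (simp add: adjacent_def)

lemma tile_potential:
  fixes w :: "complex \<Rightarrow> complex \<Rightarrow> 'v::ab_group_add"
  assumes anti: "\<And>a b. adjacent \<Lambda> a b \<Longrightarrow> w b a = - w a b"
    and closed: "w p (p + u) + w (p + u) (p + u + v) = w p (p + v) + w (p + v) (p + u + v)"
    and tile: "rhomb p u v \<in> \<Lambda>" "rhombus_sides u v"
  obtains f where "\<And>a b. closed_segment a b edge_of rhomb p u v \<Longrightarrow> f b - f a = w a b"
proof -
  define f where "f = (\<lambda>x. if x = p then 0 else if x = p + u then w p (p + u)
    else if x = p + v then w p (p + v) else w p (p + u) + w (p + u) (p + u + v))"
  have uv: "u \<noteq> 0" "v \<noteq> 0" "u \<noteq> v" "u + v \<noteq> 0" "v + u \<noteq> 0"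
    using tile(2) by (auto simp: rhombus_sides_def add_eq_0_iff add_eq_0_iff2)
  have f: "f p = 0" "f (p + u) = w p (p + u)" "f (p + v) = w p (p + v)"
    "f (p + u + v) = w p (p + u) + w (p + u) (p + u + v)"
    using uv by (simp_all add: f_def add.assoc)
  have up: "f (p + u) - f p = w p (p + u)" "f (p + v) - f p = w p (p + v)"
    "f (p + u + v) - f (p + u) = w (p + u) (p + u + v)"
    unfolding f by simp_all
  have up': "f (p + u + v) - f (p + v) = w (p + v) (p + u + v)" unfolding f closed by simp
  have "f b - f a = w a b" if e: "closed_segment a b edge_of rhomb p u v" for a b
  proof -
    have adj: "adjacent \<Lambda> b a" "adjacent \<Lambda> a b" using e tile adjacent_iff adjacent_sym by blast+
    have neg: "f b - f a = w a b" if "f a - f b = w b a" using that anti[OF adj(1)] by (metis minus_diff_eq)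
    show ?thesis using rhomb_edge_cases[OF tile(2) e] up up' neg unfolding insert_iff empty_iff doubleton_eq_iff
      by blast
  qed
  then show thesis by (rule that)
qed

text \<open>
  The discrete Poincare lemma. Potentials on single tiles are glued; on two tiles with a common
  edge their difference is constant, since both have the prescribed increment along that edge.
\<close>

theorem edge_potential:
  fixes w :: "complex \<Rightarrow> complex \<Rightarrow> 'v::ab_group_add"
  assumes anti: "\<And>a b. adjacent \<Lambda> a b \<Longrightarrow> w b a = - w a b"
    and closed: "\<And>p u v. rhomb p u v \<in> \<Lambda> \<Longrightarrow> rhombus_sides u v \<Longrightarrow>
      w p (p + u) + w (p + u) (p + u + v) = w p (p + v) + w (p + v) (p + u + v)"
  obtains F where "\<And>a b. adjacent \<Lambda> a b \<Longrightarrow> F b - F a = w a b"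
proof -
  have "\<exists>f. \<forall>a b. closed_segment a b edge_of R \<longrightarrow> f b - f a = w a b" if R: "R \<in> \<Lambda>" for R
  proof -
    obtain p u v where puv: "rhombus_sides u v" "R = rhomb p u v"
      using R tile_rhombus unit_rhombus_iff by blast
    have "rhomb p u v \<in> \<Lambda>" using R puv(2) by simp
    then obtain f where "\<And>a b. closed_segment a b edge_of rhomb p u v \<Longrightarrow> f b - f a = w a b"
      using tile_potential[of w p u v, OF anti closed[OF _ puv(1)] _ puv(1)] by blast
    then show ?thesis unfolding puv(2) by blast
  qed
  then obtain f where f: "\<And>R a b. R \<in> \<Lambda> \<Longrightarrow> closed_segment a b edge_of R \<Longrightarrow> f R b - f R a = w a b"
    by metis
  have const: "f S x - f R x = f S y - f R y"
    if "R \<in> \<Lambda>" "S \<in> \<Lambda>" "x \<in> R \<inter> S \<inter> verts \<Lambda>" "y \<in> R \<inter> S \<inter> verts \<Lambda>" for R S x y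
  proof (cases "R = S \<or> x = y")
    case True then show ?thesis by auto
  next
    case False
    then have "closed_segment x y edge_of R" "closed_segment x y edge_of S"
      using shared_edge[of R S x y] that by auto
    then have "f R y - f R x = w x y" "f S y - f S x = w x y" using f that by blast+
    then have "f S y = f R y - f R x + f S x" by (simp add: diff_eq_eq)
    then show ?thesis by (simp add: algebra_simps)
  qed
  obtain F k where F: "\<And>R x. R \<in> \<Lambda> \<Longrightarrow> x \<in> R \<inter> verts \<Lambda> \<Longrightarrow> F x = f R x + k R"
    using glue_potentials[of "verts \<Lambda>" f, OF const tiles_Int_vert] by blast
  have "F b - F a = w a b" if ab: "adjacent \<Lambda> a b" for a b
  proof -
    obtain R where R: "R \<in> \<Lambda>" "closed_segment a b edge_of R" using ab adjacent_iff by blast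
    then have "a \<in> R" "b \<in> R" using edge_of_imp_subset ends_in_segment by blast+
    then have "F a = f R a + k R" "F b = f R b + k R" using F R ab by (auto simp: adjacent_def)
    then show ?thesis using f R by simp
  qed
  then show thesis by (rule that)
qed

text \<open>
  The vertex graph is connected: a function constant along edges is constant on the corners of
  each tile, and neighbouring tiles share a vertex.
\<close>

lemma constant_along_edges:
  assumes g: "\<And>a b. adjacent \<Lambda> a b \<Longrightarrow> g a = g b" and xy: "x \<in> verts \<Lambda>" "y \<in> verts \<Lambda>"
  shows "g x = g y"
proof -
  have corners: "g a = g b" if R: "R \<in> \<Lambda>" and ab: "a \<in> verts \<Lambda>" "b \<in> verts \<Lambda>" "a \<in> R" "b \<in> R" for R a b
  proof -
    obtain p u v where puv: "rhombus_sides u v" "R = rhomb p u v"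
      using R tile_rhombus unit_rhombus_iff by blast
    have "g (p + u) = g p" "g (p + v) = g p" "g (p + u + v) = g p"
      using rhomb_adjacent[of p u v] g R puv by metis+
    moreover have "a \<in> {p, p + u, p + u + v, p + v}" "b \<in> {p, p + u, p + u + v, p + v}"
      using vert_corner ab R puv by blast+
    ultimately show ?thesis by auto
  qed
  obtain R S where RS: "R \<in> \<Lambda>" "x \<in> R" "S \<in> \<Lambda>" "y \<in> S" using tile_exists by blast
  define a where "a R = g (SOME z. z \<in> R \<inter> verts \<Lambda>)" for R
  have a: "a R = g z" if "R \<in> \<Lambda>" "z \<in> R" "z \<in> verts \<Lambda>" for R z
  proof -
    have "(SOME z. z \<in> R \<inter> verts \<Lambda>) \<in> R \<inter> verts \<Lambda>" by (rule someI[of _ z]) (use that in blast)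
    then show ?thesis unfolding a_def using corners that by blast
  qed
  have "a R = a S"
  proof (rule constant_of_overlaps[of UNIV])
    fix R S assume "R \<in> \<Lambda>" "S \<in> \<Lambda>" "R \<inter> S \<inter> UNIV \<noteq> {}"
    then obtain z where "z \<in> R \<inter> S" "z \<in> verts \<Lambda>" using tiles_Int_vert[of R S S] by auto
    then show "a R = a S" using a \<open>R \<in> \<Lambda>\<close> \<open>S \<in> \<Lambda>\<close> by auto
  qed (use RS in auto)
  then show ?thesis using a RS xy by simp
qed

lemma lattice_path_snoc:
  assumes "lattice_path \<Lambda> zs" "adjacent \<Lambda> (last zs) b"
  shows "lattice_path \<Lambda> (zs @ [b])"
  unfolding lattice_path_def
proof (intro conjI ballI)
  show "zs @ [b] \<noteq> []" by simp
  show "set (zs @ [b]) \<subseteq> verts \<Lambda>" using assms by (auto simp: lattice_path_def adjacent_def)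
  fix n assume n: "n \<in> {1..<length (zs @ [b])}"
  have ne: "zs \<noteq> []" using assms(1) by (simp add: lattice_path_def)
  show "adjacent \<Lambda> ((zs @ [b]) ! (n - 1)) ((zs @ [b]) ! n)"
  proof (cases "n = length zs")
    case True
    then have "(zs @ [b]) ! (n - 1) = last zs" using ne by (simp add: nth_append last_conv_nth)
    then show ?thesis using True assms(2) by simp
  next
    case False
    then have "n < length zs" "n - 1 < length zs" using n by auto
    then show ?thesis using assms(1) n by (auto simp: lattice_path_def nth_append)
  qed
qed

text \<open>
  Being reachable from \<open>a\<close> is constant along edges.
\<close>

lemma path_exists:
  assumes "a \<in> verts \<Lambda>" "b \<in> verts \<Lambda>"
  shows "\<exists>zs. path_from_to \<Lambda> zs a b"
proof -
  define g where "g z \<longleftrightarrow> (\<exists>zs. path_from_to \<Lambda> zs a z)" for z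
  have step: "g y" if xy: "adjacent \<Lambda> x y" and "g x" for x y
  proof -
    obtain zs where zs: "lattice_path \<Lambda> zs" "hd zs = a" "last zs = x"
      using \<open>g x\<close> by (auto simp: g_def path_from_to_def)
    then have "zs \<noteq> []" by (simp add: lattice_path_def)
    then have "path_from_to \<Lambda> (zs @ [y]) a y"
      using lattice_path_snoc[of zs y] zs xy by (simp add: path_from_to_def)
    then show ?thesis unfolding g_def by blast
  qed
  have "g x = g y" if "adjacent \<Lambda> x y" for x y using step that adjacent_sym by blast
  then have "g a = g b" using constant_along_edges assms by blast
  moreover have "path_from_to \<Lambda> [a] a a" using assms by (simp add: path_from_to_def lattice_path_def)
  ultimately show ?thesis unfolding g_def by blast
qed

end

section \<open>Discrete analytic functions and the forward shift\<close>

lemma sum_consecutive_differences: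
  fixes g :: "nat \<Rightarrow> 'a::ab_group_add"
  shows "(\<Sum>n\<in>{1..<Suc m}. g n - g (n - 1)) = g m - g 0"
  by (induction m) (simp_all add: atLeastLessThanSuc)

context rhombic_tiling
begin

definition primitive :: "(complex \<Rightarrow> complex) \<Rightarrow> (complex \<Rightarrow> complex) \<Rightarrow> bool" where
  "primitive f P \<longleftrightarrow> (\<forall>a b. adjacent \<Lambda> a b \<longrightarrow> P b - P a = (f a + f b) / 2 * (b - a))"

text \<open>
  Up to the factor \<open>v\<^sup>2 - u\<^sup>2\<close> this says that the difference quotients of \<open>f\<close> along the two
  diagonals of each tile agree.
\<close>

definition cauchy_riemann :: "(complex \<Rightarrow> complex) \<Rightarrow> bool" where
  "cauchy_riemann f \<longleftrightarrow> (\<forall>p u v. rhombus_sides u v \<longrightarrow> rhomb p u v \<in> \<Lambda> \<longrightarrow>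
     (v - u) * (f (p + u + v) - f p) = (u + v) * (f (p + v) - f (p + u)))"

lemma cauchy_riemannD:
  "cauchy_riemann f \<Longrightarrow> rhomb p u v \<in> \<Lambda> \<Longrightarrow> rhombus_sides u v \<Longrightarrow>
     (v - u) * (f (p + u + v) - f p) = (u + v) * (f (p + v) - f (p + u))"
  unfolding cauchy_riemann_def by blast

lemma path_integral_primitive:
  assumes "primitive f P" "path_from_to \<Lambda> zs a b"
  shows "path_integral f zs = P b - P a"
proof -
  have zs: "lattice_path \<Lambda> zs" "hd zs = a" "last zs = b" "zs \<noteq> []"
    using assms(2) by (auto simp: path_from_to_def lattice_path_def)
  then obtain m where m: "length zs = Suc m" by (cases zs) auto
  have "path_integral f zs = (\<Sum>n\<in>{1..<Suc m}. P (zs ! n) - P (zs ! (n - 1)))"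
    unfolding path_integral_def m
    using zs(1) assms(1) m by (intro sum.cong) (auto simp: lattice_path_def primitive_def)
  also have "\<dots> = P (zs ! m) - P (zs ! 0)"
    using sum_consecutive_differences[of "\<lambda>n. P (zs ! n)" m] by simp
  finally show ?thesis using zs m by (simp add: hd_conv_nth last_conv_nth)
qed

lemma primitive_imp_discrete_analytic: "primitive f P \<Longrightarrow> discrete_analytic \<Lambda> f"
  unfolding discrete_analytic_def by (auto simp: path_integral_primitive)

text \<open>
  The Cauchy-Riemann equation is the vanishing of the integral around one tile.
\<close>

lemma discrete_analytic_imp_cauchy_riemann:
  assumes "discrete_analytic \<Lambda> f"
  shows "cauchy_riemann f"
  unfolding cauchy_riemann_def
proof (intro allI impI)
  fix p u v assume t: "rhombus_sides u v" "rhomb p u v \<in> \<Lambda>"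
  let ?zs = "[p, p + u, p + u + v, p + v, p]"
  note adj = rhomb_adjacent[OF t(2,1)]
  have "{1..<length ?zs} = {1, 2, 3, 4}" by auto
  then have "path_from_to \<Lambda> ?zs p p"
    unfolding path_from_to_def lattice_path_def
    using adj adjacent_sym adjacent_verts by (auto simp: numeral_eq_Suc)
  then have "path_integral f ?zs = 0" using assms unfolding discrete_analytic_def by blast
  moreover have "{1..<length ?zs} = {1, 2, 3, 4}" by auto
  ultimately have "(f p + f (p + u)) / 2 * u + (f (p + u) + f (p + u + v)) / 2 * v
      + (f (p + u + v) + f (p + v)) / 2 * (- u) + (f (p + v) + f p) / 2 * (- v) = 0"
    by (simp add: path_integral_def)
  then show "(v - u) * (f (p + u + v) - f p) = (u + v) * (f (p + v) - f (p + u))"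
    by (simp add: field_simps) algebra
qed

lemma cauchy_riemann_imp_primitive:
  assumes "cauchy_riemann f"
  obtains P where "primitive f P"
proof -
  obtain P where "\<And>a b. adjacent \<Lambda> a b \<Longrightarrow> P b - P a = (f a + f b) / 2 * (b - a)"
  proof (rule edge_potential[where w = "\<lambda>a b. (f a + f b) / 2 * (b - a)"])
    fix p u v assume t: "rhomb p u v \<in> \<Lambda>" "rhombus_sides u v"
    have "(v - u) * (f (p + u + v) - f p) = (u + v) * (f (p + v) - f (p + u))"
      using cauchy_riemannD[OF assms t] .
    then show "(f p + f (p + u)) / 2 * (p + u - p) + (f (p + u) + f (p + u + v)) / 2 * (p + u + v - (p + u))
      = (f p + f (p + v)) / 2 * (p + v - p) + (f (p + v) + f (p + u + v)) / 2 * (p + u + v - (p + v))"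
      by (simp add: field_simps) algebra
  qed (auto simp: field_simps)
  then show thesis using that unfolding primitive_def by blast
qed

lemma discrete_analytic_iff: "discrete_analytic \<Lambda> f \<longleftrightarrow> cauchy_riemann f"
  using discrete_analytic_imp_cauchy_riemann cauchy_riemann_imp_primitive
    primitive_imp_discrete_analytic by metis

lemma Z_plus_primitive:
  assumes "primitive f P" "0 \<in> verts \<Lambda>" "z \<in> verts \<Lambda>"
  shows "Z_plus \<Lambda> f z = (f 0 - f z) / 2 + (P z - P 0)"
proof -
  have "path_from_to \<Lambda> (SOME zs. path_from_to \<Lambda> zs 0 z) 0 z"
    using path_exists[OF assms(2,3)] by (rule someI_ex)
  then have "discrete_integral \<Lambda> f 0 z = P z - P 0"
    unfolding discrete_integral_def by (rule path_integral_primitive[OF assms(1)])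
  then show ?thesis using assms(3) by (simp add: Z_plus_def)
qed

text \<open>
  The edge equations, which turn the inversion of the forward shift into a first order
  difference equation.
\<close>

lemma Z_plus_edge:
  assumes "discrete_analytic \<Lambda> f" "0 \<in> verts \<Lambda>" "adjacent \<Lambda> a b"
  shows "2 * (Z_plus \<Lambda> f b - Z_plus \<Lambda> f a) = (b - a - 1) * f b + (b - a + 1) * f a"
proof -
  obtain P where P: "primitive f P"
    using assms(1) cauchy_riemann_imp_primitive discrete_analytic_iff by blast
  have "P b - P a = (f a + f b) / 2 * (b - a)" using P assms(3) by (simp add: primitive_def)
  moreover have "Z_plus \<Lambda> f b = (f 0 - f b) / 2 + (P b - P 0)" "Z_plus \<Lambda> f a = (f 0 - f a) / 2 + (P a - P 0)"
    using Z_plus_primitive[OF P assms(2)] adjacent_verts[OF assms(3)] by blast+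
  ultimately show ?thesis by (simp add: field_simps) algebra
qed

lemma Z_plus_in_DA_space:
  assumes f: "f \<in> DA_space \<Lambda>" and zero: "0 \<in> verts \<Lambda>"
  shows "Z_plus \<Lambda> f \<in> DA_space \<Lambda>" "Z_plus \<Lambda> f 0 = 0"
proof -
  have da: "discrete_analytic \<Lambda> f" using f by (simp add: DA_space_def)
  then obtain P where P: "primitive f P"
    using cauchy_riemann_imp_primitive discrete_analytic_iff by blast
  show "Z_plus \<Lambda> f 0 = 0" using Z_plus_primitive[OF P zero zero] by simp
  have "cauchy_riemann (Z_plus \<Lambda> f)"
    unfolding cauchy_riemann_def
  proof (intro allI impI)
    fix p u v assume t: "rhombus_sides u v" "rhomb p u v \<in> \<Lambda>"
    note adj = rhomb_adjacent[OF t(2,1)]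
    have cr: "(v - u) * (f (p + u + v) - f p) = (u + v) * (f (p + v) - f (p + u))"
      using cauchy_riemannD[OF _ t(2,1)] da discrete_analytic_iff by blast
    have e: "2 * (Z_plus \<Lambda> f (p + u) - Z_plus \<Lambda> f p) = (u - 1) * f (p + u) + (u + 1) * f p"
      "2 * (Z_plus \<Lambda> f (p + v) - Z_plus \<Lambda> f p) = (v - 1) * f (p + v) + (v + 1) * f p"
      "2 * (Z_plus \<Lambda> f (p + u + v) - Z_plus \<Lambda> f (p + u)) = (v - 1) * f (p + u + v) + (v + 1) * f (p + u)"
      using Z_plus_edge[OF da zero adj(1)] Z_plus_edge[OF da zero adj(2)] Z_plus_edge[OF da zero adj(3)]
      by simp_all
    show "(v - u) * (Z_plus \<Lambda> f (p + u + v) - Z_plus \<Lambda> f p)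
        = (u + v) * (Z_plus \<Lambda> f (p + v) - Z_plus \<Lambda> f (p + u))"
      using cr e by algebra
  qed
  then show "Z_plus \<Lambda> f \<in> DA_space \<Lambda>"
    using discrete_analytic_iff by (simp add: DA_space_def Z_plus_def)
qed

text \<open>
  If \<open>F\<close> is to be the forward shift of \<open>f\<close>, then \<open>F + f / 2\<close> is up to a constant the integral of
  \<open>f\<close>. The edge equations say precisely that it is a primitive, which yields the discrete
  analyticity of \<open>f\<close> as well.
\<close>

lemma Z_plus_eqI:
  assumes zero: "0 \<in> verts \<Lambda>" "F 0 = 0" and off: "\<And>z. z \<notin> verts \<Lambda> \<Longrightarrow> F z = 0 \<and> f z = 0"
    and edge: "\<And>a b. adjacent \<Lambda> a b \<Longrightarrow> (b - a - 1) * f b + (b - a + 1) * f a = 2 * (F b - F a)"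
  shows "f \<in> DA_space \<Lambda>" "Z_plus \<Lambda> f = F"
proof -
  have P: "primitive f (\<lambda>z. F z + f z / 2)"
    unfolding primitive_def
  proof (intro allI impI)
    fix a b assume "adjacent \<Lambda> a b"
    then show "F b + f b / 2 - (F a + f a / 2) = (f a + f b) / 2 * (b - a)"
      using edge[of a b] by (simp add: field_simps) algebra
  qed
  then show "f \<in> DA_space \<Lambda>" using off primitive_imp_discrete_analytic by (simp add: DA_space_def)
  show "Z_plus \<Lambda> f = F"
  proof
    fix z show "Z_plus \<Lambda> f z = F z"
      using Z_plus_primitive[OF P zero(1), of z] off[of z] zero(2)
      by (cases "z \<in> verts \<Lambda>") (simp_all add: field_simps Z_plus_def)
  qed
qed

text \<open>
  With vanishing right-hand side the edge equation gives \<open>f = 0\<close> at the left end of the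
  horizontal last edge of the path, and this value is carried back to \<open>z\<close>: the coefficient of
  the earlier endpoint vanishes only for an edge with direction \<open>- 1\<close>.
\<close>

lemma Z_plus_injective:
  assumes f: "f \<in> DA_space \<Lambda>" "Z_plus \<Lambda> f = (\<lambda>_. 0)" and zero: "0 \<in> verts \<Lambda>"
    and exit: "\<And>z. z \<in> verts \<Lambda> \<Longrightarrow>
           \<exists>N zs. lattice_path \<Lambda> zs \<and> N \<ge> 1 \<and> length zs = N + 1 \<and> zs ! 0 = z \<and>
             (\<forall>n\<in>{1..N - 1}. zs ! n - zs ! (n - 1) \<noteq> 1 \<and> zs ! n - zs ! (n - 1) \<noteq> - 1) \<and>
             zs ! N - zs ! (N - 1) = 1"
  shows "f = (\<lambda>_. 0)"
proof
  fix z
  show "f z = 0"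
  proof (cases "z \<in> verts \<Lambda>")
    case False
    then show ?thesis using f(1) by (simp add: DA_space_def)
  next
    case True
    obtain N zs where zs: "lattice_path \<Lambda> zs" "N \<ge> 1" "length zs = N + 1" "zs ! 0 = z"
      and noh: "\<forall>n\<in>{1..N - 1}. zs ! n - zs ! (n - 1) \<noteq> 1 \<and> zs ! n - zs ! (n - 1) \<noteq> - 1"
      and last: "zs ! N - zs ! (N - 1) = 1"
      using exit[OF True] by blast
    have adj: "adjacent \<Lambda> (zs ! n) (zs ! Suc n)" if "n < N" for n
    proof -
      have "Suc n \<in> {1..<length zs}" using that zs(3) by simp
      then show ?thesis using zs(1) unfolding lattice_path_def by (metis diff_Suc_1)
    qed
    have eq: "(b - a - 1) * f b + (b - a + 1) * f a = 0" if "adjacent \<Lambda> a b" for a b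
      using Z_plus_edge[OF _ zero that, of f] f by (simp add: DA_space_def)
    have "f (zs ! (N - 1 - k)) = 0" if "k \<le> N - 1" for k
      using that
    proof (induction k)
      case 0
      have "adjacent \<Lambda> (zs ! (N - 1)) (zs ! N)" using adj[of "N - 1"] zs(2) by simp
      from eq[OF this] show ?case unfolding last by simp
    next
      case (Suc k)
      define n where "n = N - 1 - Suc k"
      have n: "N - 1 - k = Suc n" "n < N" "Suc n \<in> {1..N - 1}" using Suc.prems by (auto simp: n_def)
      have "f (zs ! Suc n) = 0" using Suc n(1) by simp
      then have "(zs ! Suc n - zs ! n + 1) * f (zs ! n) = 0" using eq[OF adj[OF n(2)]] by simp
      moreover have "zs ! Suc n - zs ! n + 1 \<noteq> 0"
        using noh n(3) by (metis add_eq_0_iff2 diff_Suc_1)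
      ultimately show ?case unfolding n_def[symmetric] by simp
    qed
    from this[of "N - 1"] show ?thesis using zs(4) by simp
  qed
qed

end

section \<open>Strips of tiles with horizontal edges\<close>

text \<open>
  Splitting off the first point of an orbit; solutions of difference equations along an orbit
  arise from this.
\<close>

lemma sum_along_orbit:
  fixes g :: "'a \<Rightarrow> 'b::ab_group_add"
  assumes "finite {j. P ((f ^^ j) x)}"
  shows "(\<Sum>j | P ((f ^^ j) x). g ((f ^^ j) x)) =
    (if P x then g x else 0) + (\<Sum>j | P ((f ^^ j) (f x)). g ((f ^^ j) (f x)))"
proof -
  let ?A = "{j. P ((f ^^ j) x)}" and ?B = "{j. P ((f ^^ j) (f x))}"
  have shift: "(f ^^ Suc j) x = (f ^^ j) (f x)" for j by (simp add: funpow_swap1)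
  have A: "?A = (if P x then {0} else {}) \<union> Suc ` ?B"
  proof (rule set_eqI)
    fix j show "j \<in> ?A \<longleftrightarrow> j \<in> (if P x then {0} else {}) \<union> Suc ` ?B"
      by (cases j) (auto simp: shift simp del: funpow.simps(2))
  qed
  have "finite (Suc ` ?B)" using assms A by (metis finite_Un)
  then have "(\<Sum>j\<in>?A. g ((f ^^ j) x)) =
      (\<Sum>j\<in>(if P x then {0} else {}). g ((f ^^ j) x)) + (\<Sum>j\<in>Suc ` ?B. g ((f ^^ j) x))"
    unfolding A by (intro sum.union_disjoint) auto
  also have "(\<Sum>j\<in>Suc ` ?B. g ((f ^^ j) x)) = (\<Sum>j\<in>?B. g ((f ^^ j) (f x)))"
    by (simp add: sum.reindex shift del: funpow.simps(2))
  finally show ?thesis by simp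
qed

context rhombic_tiling
begin

text \<open>
  A rung is a horizontal edge, represented by its left end. Two rungs \<open>p\<close> and \<open>q\<close> that are
  opposite sides of the same tile are consecutive in a strip.
\<close>

definition rung :: "complex \<Rightarrow> bool" where
  "rung p \<longleftrightarrow> adjacent \<Lambda> p (p + 1)"

definition strip_tile :: "complex \<Rightarrow> complex \<Rightarrow> bool" where
  "strip_tile p q \<longleftrightarrow> rhombus_sides 1 (q - p) \<and> rhomb p 1 (q - p) \<in> \<Lambda>"

lemma strip_tile_sym: "strip_tile p q \<Longrightarrow> strip_tile q p"
proof -
  assume *: "strip_tile p q"
  then have "rhombus_sides 1 (p - q)"
    unfolding strip_tile_def rhombus_sides_def
    by (metis minus_diff_eq norm_minus_commute minus_minus)
  moreover have "rhomb p 1 (q - p) = rhomb q 1 (p - q)"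
    using rhomb_swap[of p 1 "q - p"] rhomb_shift[of p "q - p" 1] rhomb_swap[of q 1 "p - q"] by simp
  ultimately show ?thesis using * by (simp add: strip_tile_def)
qed

lemma strip_tile_Im: "strip_tile p q \<Longrightarrow> Im q \<noteq> Im p"
  using rhombus_sides_1(1)[of "q - p"] by (simp add: strip_tile_def)

lemma strip_tile_adjacent:
  assumes "strip_tile p q"
  shows "rung p" "rung q" "adjacent \<Lambda> p q" "adjacent \<Lambda> (p + 1) (q + 1)"
  using rhomb_adjacent[of p 1 "q - p"] assms unfolding strip_tile_def rung_def
  by (simp_all add: add.commute)

text \<open>
  There is a tile on either side (\<open>\<sigma> = 1\<close> above, \<open>\<sigma> = - 1\<close> below) of a rung. A tile containing a
  point slightly off the midpoint of the rung also contains the midpoint. Its intersection with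
  a tile bounded by the rung is a face through an inner point of the rung, so it contains the
  entire rung.
\<close>

lemma strip_tile_exists:
  assumes p: "rung p" and \<sigma>: "\<sigma> = 1 \<or> \<sigma> = (- 1 :: real)"
  shows "\<exists>q. strip_tile p q \<and> \<sigma> * (Im q - Im p) > 0"
proof -
  obtain R where R: "R \<in> \<Lambda>" "closed_segment p (p + 1) edge_of R"
    using p unfolding rung_def adjacent_iff by blast
  define m where "m = midpoint p (p + 1)"
  have m: "m = p + 1 / 2" by (simp add: m_def midpoint_def complex_eq_iff)
  have mo: "m \<in> open_segment p (p + 1)" unfolding m_def by (simp add: midpoint_in_open_segment)
  have corners: "p \<in> R" "p + 1 \<in> R" using R(2) edge_of_imp_subset ends_in_segment by blast+
  have mR: "m \<in> R" using mo R(2) edge_of_imp_subset open_closed_segment by blast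
  obtain e where e: "e > 0" "\<forall>R\<in>\<Lambda>. R \<inter> ball m e \<noteq> {} \<longrightarrow> m \<in> R" using star by blast
  define y where "y = m + \<i> * of_real (\<sigma> * (e / 2))"
  have "dist m y = e / 2" using \<sigma> e(1) by (auto simp: y_def dist_norm norm_mult)
  then have yb: "y \<in> ball m e" using e(1) by simp
  obtain S where S: "S \<in> \<Lambda>" "y \<in> S" using cover by blast
  then have mS: "m \<in> S" using e(2) yb by blast
  have "closed_segment p (p + 1) edge_of S"
  proof (cases "R = S")
    case False
    have "p \<in> R \<inter> S \<and> p + 1 \<in> R \<inter> S"
      using face_ofD[OF tile_Int_face[OF R(1) S(1)] mo corners] mR mS by blast
    then show ?thesis
      using shared_edge(2)[OF R(1) S(1) False, of p "p + 1"] p unfolding rung_def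
      by (simp add: adjacent_verts)
  qed (use R in simp)
  then obtain v where v: "rhombus_sides 1 v" "S = rhomb p 1 v"
    using unit_rhombus_edge_normal_form[OF tile_rhombus[OF S(1)], of p "p + 1"] by auto
  obtain s t where st: "y = p + of_real s * 1 + of_real t * v" "0 \<le> t"
    using S(2) v(2) rhomb_memE by blast
  have "Im y = Im p + \<sigma> * (e / 2)" by (simp add: y_def m)
  then have "\<sigma> * (e / 2) = t * Im v" using arg_cong[OF st(1), of Im] by simp
  then have "\<sigma> * (t * Im v) > 0" using \<sigma> e(1) by auto
  then have "t * (\<sigma> * Im v) > 0" by (simp add: mult.left_commute)
  then have "\<sigma> * Im v > 0" using st(2) by (simp add: zero_less_mult_iff)
  then show ?thesis using v S(1) by (intro exI[of _ "p + v"]) (simp add: strip_tile_def)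
qed

lemma strip_tile_unique:
  assumes "strip_tile p q" "strip_tile p q'" and same: "(Im q - Im p) * (Im q' - Im p) > 0"
  shows "q = q'"
proof -
  define v v' where "v = q - p" and "v' = q' - p"
  have v: "rhombus_sides 1 v" "rhomb p 1 v \<in> \<Lambda>" and v': "rhombus_sides 1 v'" "rhomb p 1 v' \<in> \<Lambda>"
    using assms by (simp_all add: strip_tile_def v_def v'_def)
  have pos: "Im v * Im v' > 0" using same by (simp add: v_def v'_def)
  \<comment> \<open>The heights are chosen so that both tiles contain the same point close to the midpoint.\<close>
  have "\<bar>Im v'\<bar> / 4 * Im v = \<bar>Im v\<bar> / 4 * Im v'"
    using pos by (auto simp: zero_less_mult_iff abs_if)
  then have "p + 1 / 2 + \<i> * of_real (\<bar>Im v'\<bar> / 4 * Im v) \<in> interior (rhomb p 1 v) \<inter> interior (rhomb p 1 v')"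
    using rhomb_1_near_side[OF v(1), of "\<bar>Im v'\<bar> / 4" p] rhomb_1_near_side[OF v'(1), of "\<bar>Im v\<bar> / 4" p]
      rhombus_sides_1[OF v(1)] rhombus_sides_1[OF v'(1)] by simp
  then have eq: "rhomb p 1 v = rhomb p 1 v'" using tile_eqI v(2) v'(2) by blast
  have "p + v extreme_point_of rhomb p 1 v'" "p + v' extreme_point_of rhomb p 1 v"
    using rhomb_extreme_points[OF v(1), of "p + v" p] rhomb_extreme_points[OF v'(1), of "p + v'" p] eq
    by simp_all
  then have "p + v \<in> {p, p + 1, p + 1 + v', p + v'}" "p + v' \<in> {p, p + 1, p + 1 + v, p + v}"
    using rhomb_extreme_points[OF v(1), of "p + v'" p] rhomb_extreme_points[OF v'(1), of "p + v" p]
    by simp_all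
  then have "v = v'"
    using rhombus_sides_1[OF v(1)] rhombus_sides_1[OF v'(1)] by (auto simp: add.assoc)
  then show ?thesis by (simp add: v_def v'_def)
qed

definition up :: "complex \<Rightarrow> complex" where
  "up p = (SOME q. strip_tile p q \<and> Im q > Im p)"

definition down :: "complex \<Rightarrow> complex" where
  "down p = (SOME q. strip_tile p q \<and> Im q < Im p)"

lemma up:
  assumes "rung p"
  shows "strip_tile p (up p)" "Im (up p) > Im p"
  using someI_ex[of "\<lambda>q. strip_tile p q \<and> Im q > Im p"] strip_tile_exists[OF assms, of 1]
  unfolding up_def by auto

lemma down:
  assumes "rung p"
  shows "strip_tile p (down p)" "Im (down p) < Im p"
  using someI_ex[of "\<lambda>q. strip_tile p q \<and> Im q < Im p"] strip_tile_exists[OF assms, of "- 1"]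
  unfolding down_def by auto

lemma strip_tile_up:
  assumes "strip_tile p q" "Im q > Im p"
  shows "up p = q"
proof (rule strip_tile_unique[OF _ assms(1)])
  show "strip_tile p (up p)" using up(1) strip_tile_adjacent(1)[OF assms(1)] .
  show "(Im (up p) - Im p) * (Im q - Im p) > 0"
    using up(2) strip_tile_adjacent(1)[OF assms(1)] assms(2) by simp
qed

lemma up_down: "rung p \<Longrightarrow> up (down p) = p"
  using strip_tile_up strip_tile_sym down by blast

lemma down_up:
  assumes "rung p"
  shows "down (up p) = p"
proof (rule strip_tile_unique)
  have q: "rung (up p)" using strip_tile_adjacent(2) up(1) assms by blast
  show "strip_tile (up p) (down (up p))" "strip_tile (up p) p"
    using down(1)[OF q] strip_tile_sym[OF up(1)[OF assms]] .
  show "(Im (down (up p)) - Im (up p)) * (Im p - Im (up p)) > 0"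
    using down(2)[OF q] up(2)[OF assms] by (intro mult_neg_neg) simp_all
qed

text \<open>
  A tile contains a ball of fixed radius, so its height is bounded below; therefore each strip
  climbs through all heights.
\<close>

lemma strip_tile_height:
  obtains r where "r > 0" "\<And>p q. strip_tile p q \<Longrightarrow> \<bar>Im q - Im p\<bar> \<ge> r"
proof -
  obtain r where r: "r > 0" "\<And>R. R \<in> \<Lambda> \<Longrightarrow> \<exists>c. ball c r \<subseteq> R" using tile_inradius by blast
  have "\<bar>Im q - Im p\<bar> \<ge> r" if "strip_tile p q" for p q
  proof -
    have "rhomb p 1 (q - p) \<in> \<Lambda>" using that by (simp add: strip_tile_def)
    then obtain c where c: "ball c r \<subseteq> rhomb p 1 (q - p)" using r(2) by blast
    have mem: "c + \<i> * of_real (r / 2) \<in> rhomb p 1 (q - p)" "c - \<i> * of_real (r / 2) \<in> rhomb p 1 (q - p)"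
      using r(1) by (auto intro!: subsetD[OF c] simp: dist_norm norm_mult)
    obtain s t where st: "c + \<i> * of_real (r / 2) = p + of_real s * 1 + of_real t * (q - p)" "0 \<le> t" "t \<le> 1"
      using mem(1) rhomb_memE by blast
    obtain s' t' where st': "c - \<i> * of_real (r / 2) = p + of_real s' * 1 + of_real t' * (q - p)" "0 \<le> t'" "t' \<le> 1"
      using mem(2) rhomb_memE by blast
    have "r = (t - t') * (Im q - Im p)"
      using arg_cong[OF st(1), of Im] arg_cong[OF st'(1), of Im] by (simp add: algebra_simps)
    then have "r = \<bar>t - t'\<bar> * \<bar>Im q - Im p\<bar>" using r(1) by (metis abs_mult abs_of_pos)
    also have "\<dots> \<le> 1 * \<bar>Im q - Im p\<bar>" using st st' by (intro mult_right_mono) auto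
    finally show ?thesis by simp
  qed
  with r(1) show thesis by (rule that)
qed

lemma rung_orbit: "rung p \<Longrightarrow> rung ((up ^^ j) p)" "rung p \<Longrightarrow> rung ((down ^^ j) p)"
  by (induction j) (auto intro: strip_tile_adjacent(2) up(1) down(1))

lemma orbit_heights:
  obtains r where "r > 0" "\<And>p j. rung p \<Longrightarrow> Im ((up ^^ j) p) \<ge> Im p + real j * r"
    "\<And>p j. rung p \<Longrightarrow> Im ((down ^^ j) p) \<le> Im p - real j * r"
proof -
  obtain r where r: "r > 0" "\<And>p q. strip_tile p q \<Longrightarrow> \<bar>Im q - Im p\<bar> \<ge> r"
    using strip_tile_height by blast
  have u: "Im (up p) \<ge> Im p + r" and d: "Im (down p) \<le> Im p - r" if "rung p" for p
    using up[OF that] down[OF that] r(2)[of p "up p"] r(2)[of p "down p"] by auto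
  have "Im ((up ^^ j) p) \<ge> Im p + real j * r" if "rung p" for p j
  proof (induction j)
    case (Suc j)
    then show ?case using u[OF rung_orbit(1)[OF that, of j]] by (simp add: algebra_simps)
  qed simp
  moreover have "Im ((down ^^ j) p) \<le> Im p - real j * r" if "rung p" for p j
  proof (induction j)
    case (Suc j)
    then show ?case using d[OF rung_orbit(2)[OF that, of j]] by (simp add: algebra_simps)
  qed simp
  ultimately show thesis using r(1) that by blast
qed

text \<open>
  A difference equation along the strips has a solution, since strips do not close up. The sums
  extend from the given rung to height \<open>0\<close>, which makes them finite and needs no choice of a
  base point on each strip: \<open>U\<close> collects the rungs above the given one, \<open>D\<close> those below, and in
  either case only those before height \<open>0\<close> is reached.
\<close>

lemma strip_summation:
  fixes g :: "complex \<Rightarrow> 'v::ab_group_add"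
  obtains T where "\<And>p. rung p \<Longrightarrow> T (up p) - T p = g p"
proof -
  obtain r where r: "r > 0" "\<And>p j. rung p \<Longrightarrow> Im ((up ^^ j) p) \<ge> Im p + real j * r"
    "\<And>p j. rung p \<Longrightarrow> Im ((down ^^ j) p) \<le> Im p - real j * r" using orbit_heights by blast
  have fin: "finite {j. Im ((up ^^ j) p) < 0}" "finite {j. Im ((down ^^ j) p) \<ge> 0}" if p: "rung p" for p
  proof -
    obtain n where "\<bar>Im p\<bar> / r < real n" using reals_Archimedean2 by blast
    then have n: "\<bar>Im p\<bar> < real n * r" using r(1) by (simp add: field_simps)
    have bound: "\<bar>Im p\<bar> < real j * r" if "n \<le> j" for j
    proof -
      have "real n * r \<le> real j * r" using that r(1) by (intro mult_right_mono) auto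
      then show ?thesis using n by simp
    qed
    have "j < n" if "Im ((up ^^ j) p) < 0" for j
      using bound[of j] r(2)[OF p, of j] that by linarith
    moreover have "j < n" if "Im ((down ^^ j) p) \<ge> 0" for j
      using bound[of j] r(3)[OF p, of j] that by linarith
    ultimately show "finite {j. Im ((up ^^ j) p) < 0}" "finite {j. Im ((down ^^ j) p) \<ge> 0}"
      by (meson bounded_nat_set_is_finite mem_Collect_eq)+
  qed
  define U where "U p = (\<Sum>j | Im ((up ^^ j) p) < 0. g ((up ^^ j) p))" for p
  define D where "D p = (\<Sum>j | Im ((down ^^ j) p) \<ge> 0. g ((down ^^ j) p))" for p
  define T where "T p = D (down p) - U p" for p
  have "T (up p) - T p = g p" if p: "rung p" for p
  proof -
    have "down (up p) = p" using p by (rule down_up)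
    moreover have "U p = (if Im p < 0 then g p else 0) + U (up p)"
      unfolding U_def by (rule sum_along_orbit[where P = "\<lambda>z. Im z < 0", OF fin(1)[OF p]])
    moreover have "D p = (if Im p \<ge> 0 then g p else 0) + D (down p)"
      unfolding D_def by (rule sum_along_orbit[where P = "\<lambda>z. Im z \<ge> 0", OF fin(2)[OF p]])
    ultimately show ?thesis by (simp add: T_def)
  qed
  then show thesis by (rule that)
qed

section \<open>The level function\<close>

text \<open>
  On a tile with horizontal edges this is, up to a constant, the coordinate of \<open>x\<close> along the
  horizontal side; it grows from left to right by \<open>1\<close>. The other side \<open>v\<close> is determined up to
  sign, so the quotient does not depend on the choice.
\<close>

definition tile_level :: "complex set \<Rightarrow> complex \<Rightarrow> real" where
  "tile_level R x = (if \<exists>p v. rhombus_sides 1 v \<and> R = rhomb p 1 v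
     then Re x - Im x * (let v = SOME v. \<exists>p. rhombus_sides 1 v \<and> R = rhomb p 1 v in Re v / Im v)
     else 0)"

lemma tile_level_strip:
  assumes v: "rhombus_sides 1 v"
  shows "tile_level (rhomb p 1 v) x = Re x - Im x * (Re v / Im v)"
proof -
  define v' where "v' = (SOME v'. \<exists>p'. rhombus_sides 1 v' \<and> rhomb p 1 v = rhomb p' 1 v')"
  obtain p' where p': "rhombus_sides 1 v'" "rhomb p 1 v = rhomb p' 1 v'"
    using someI_ex[of "\<lambda>v'. \<exists>p'. rhombus_sides 1 v' \<and> rhomb p 1 v = rhomb p' 1 v'"] v
    unfolding v'_def by blast
  have "closed_segment p (p + v) edge_of rhomb p' 1 v'" using rhomb_side_edges(2)[OF v, of p] p'(2) by simp
  then have "p + v - p \<in> {1, - 1, v', - v'}" by (rule rhomb_edge_direction[OF p'(1)])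
  then have "v = v' \<or> v = - v'" using rhombus_sides_1(4,5)[OF v] by auto
  then have "Re v' / Im v' = Re v / Im v" by auto
  moreover have "\<exists>q v'. rhombus_sides 1 v' \<and> rhomb p 1 v = rhomb q 1 v'" using v by blast
  ultimately show ?thesis unfolding tile_level_def v'_def[symmetric] Let_def by simp
qed

lemma tile_level_other: "\<nexists>p v. rhombus_sides 1 v \<and> R = rhomb p 1 v \<Longrightarrow> tile_level R x = 0"
  unfolding tile_level_def by (rule if_not_P)

text \<open>
  The increment of the level along part of an edge depends on the edge only and not on the tile,
  which makes the tile levels compatible on common edges.
\<close>

lemma tile_level_edge:
  assumes R: "unit_rhombus R" and e: "closed_segment a b edge_of R" and xy: "y - x = of_real c * (b - a)"
  shows "tile_level R y - tile_level R x = c * (if Im (b - a) = 0 then Re (b - a) else 0)"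
proof (cases "\<exists>p v. rhombus_sides 1 v \<and> R = rhomb p 1 v")
  case True
  then obtain p v where v: "rhombus_sides 1 v" "R = rhomb p 1 v" by blast
  have d: "Re y - Re x = c * Re (b - a)" "Im y - Im x = c * Im (b - a)"
    using arg_cong[OF xy, of Re] arg_cong[OF xy, of Im] by simp_all
  define r where "r = Re v / Im v"
  have "tile_level R y - tile_level R x = (Re y - Re x) - (Im y - Im x) * r"
    unfolding v(2) tile_level_strip[OF v(1)] r_def[symmetric] by (simp add: algebra_simps)
  also have "\<dots> = c * (Re (b - a) - Im (b - a) * r)"
    unfolding d by (simp add: algebra_simps)
  also have "Re (b - a) - Im (b - a) * r = (if Im (b - a) = 0 then Re (b - a) else 0)"
  proof -
    have "b - a \<in> {1, - 1, v, - v}" using rhomb_edge_direction[OF v(1)] e v(2) by blast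
    moreover have "\<forall>w\<in>{1, - 1, v, - v}. Re w - Im w * r = (if Im w = 0 then Re w else 0)"
      using rhombus_sides_1(1)[OF v(1)] by (simp add: r_def)
    ultimately show ?thesis by (rule bspec[rotated])
  qed
  finally show ?thesis .
next
  case False
  obtain v where v: "rhombus_sides (b - a) v" "R = rhomb a (b - a) v"
    using unit_rhombus_edge_normal_form[OF R e] .
  have "Im (b - a) \<noteq> 0"
  proof
    assume "Im (b - a) = 0"
    then have "b - a = 1 \<or> b - a = - 1" using unit_complex_Im_0 v(1) by (simp add: rhombus_sides_def)
    then show False
    proof
      assume "b - a = 1" then show False using False v by metis
    next
      assume "b - a = - 1"
      then have "rhombus_sides 1 v" "R = rhomb (a + - 1) 1 v"
        using rhombus_sides_neg[OF v(1)] v(2) rhomb_shift[of a "- 1" v] by simp_all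
      then show False using False by blast
    qed
  qed
  then show ?thesis using tile_level_other[OF False] by simp
qed

lemma level_exists:
  obtains L where "\<And>R. R \<in> \<Lambda> \<Longrightarrow> \<exists>k. \<forall>x\<in>R. L x = tile_level R x + k"
proof -
  have const: "tile_level S x - tile_level R x = tile_level S y - tile_level R y"
    if RS: "R \<in> \<Lambda>" "S \<in> \<Lambda>" "x \<in> R \<inter> S \<inter> UNIV" "y \<in> R \<inter> S \<inter> UNIV" for R S x y
  proof (cases "R = S \<or> x = y")
    case True then show ?thesis by auto
  next
    case False
    then obtain a b where ab: "R \<inter> S = closed_segment a b" "closed_segment a b edge_of R"
      "closed_segment a b edge_of S"
      using tiles_Int_edge[of R S x y] RS by auto
    obtain s where s: "x = a + of_real s * (b - a)"
      using RS(3) ab(1) by (auto simp: in_segment scaleR_conv_of_real algebra_simps)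
    obtain t where t: "y = a + of_real t * (b - a)"
      using RS(4) ab(1) by (auto simp: in_segment scaleR_conv_of_real algebra_simps)
    have eq: "y - x = of_real (t - s) * (b - a)" unfolding s t by (simp add: algebra_simps)
    have "tile_level R y - tile_level R x = tile_level S y - tile_level S x"
      using tile_level_edge[OF tile_rhombus[OF RS(1)] ab(2) eq]
        tile_level_edge[OF tile_rhombus[OF RS(2)] ab(3) eq] by simp
    then show ?thesis by simp
  qed
  obtain L k where "\<And>R x. R \<in> \<Lambda> \<Longrightarrow> x \<in> R \<inter> UNIV \<Longrightarrow> L x = tile_level R x + k R"
    using glue_potentials[of UNIV tile_level, OF const] by blast
  then show thesis using that[of L] by blast
qed

definition level :: "complex \<Rightarrow> real" where
  "level = (SOME L. \<forall>R\<in>\<Lambda>. \<exists>k. \<forall>x\<in>R. L x = tile_level R x + k)"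

lemma level_tile:
  assumes "R \<in> \<Lambda>" "x \<in> R" "y \<in> R"
  shows "level y - level x = tile_level R y - tile_level R x"
proof -
  have "\<exists>L. \<forall>R\<in>\<Lambda>. \<exists>k. \<forall>x\<in>R. L x = tile_level R x + k"
    using level_exists by metis
  then have "\<forall>R\<in>\<Lambda>. \<exists>k. \<forall>x\<in>R. level x = tile_level R x + k"
    unfolding level_def by (rule someI_ex)
  then obtain k where "\<forall>x\<in>R. level x = tile_level R x + k" using assms(1) by blast
  then show ?thesis using assms(2,3) by simp
qed

lemma level_nonhorizontal_edge:
  assumes "adjacent \<Lambda> a b" "Im (b - a) \<noteq> 0"
  shows "level b = level a"
proof -
  obtain R where R: "R \<in> \<Lambda>" "closed_segment a b edge_of R" using assms(1) adjacent_iff by blast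
  then have "a \<in> R" "b \<in> R" using edge_of_imp_subset ends_in_segment by blast+
  then show ?thesis
    using level_tile[OF R(1), of a b] tile_level_edge[OF tile_rhombus[OF R(1)] R(2), of b a 1] assms(2)
    by simp
qed

lemma level_strip_tile:
  assumes "strip_tile p q" "0 \<le> s" "s \<le> 1" "0 \<le> t" "t \<le> 1"
  shows "level (p + of_real s + of_real t * (q - p)) = level p + s"
proof -
  define v where "v = q - p"
  have v: "rhombus_sides 1 v" "rhomb p 1 v \<in> \<Lambda>" using assms(1) by (simp_all add: strip_tile_def v_def)
  define k where "k = Re v / Im v"
  have k: "Re v = Im v * k" using rhombus_sides_1(1)[OF v(1)] by (simp add: k_def)
  have "p + of_real s * 1 + of_real t * v \<in> rhomb p 1 v" using assms by (intro rhomb_memI)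
  then have "level (p + of_real s + of_real t * v) - level p =
      tile_level (rhomb p 1 v) (p + of_real s + of_real t * v) - tile_level (rhomb p 1 v) p"
    using level_tile[OF v(2) rhomb_corners(1)] by simp
  also have "\<dots> = s"
    unfolding tile_level_strip[OF v(1)] k_def[symmetric] by (simp add: k algebra_simps)
  finally show ?thesis by (simp add: v_def)
qed

lemma tile_level_mono:
  assumes "unit_rhombus R" "Re x \<le> Re y" "Im x = Im y"
  shows "tile_level R x \<le> tile_level R y"
  using tile_level_strip tile_level_other[of R] assms(2,3)
  by (cases "\<exists>p v. rhombus_sides 1 v \<and> R = rhomb p 1 v") auto

text \<open>
  Near a point the level is compared with its value at the point inside a single tile, where it
  is monotone.
\<close>

lemma level_mono:
  assumes "Re x \<le> Re y" "Im x = Im y"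
  shows "level x \<le> level y"
proof -
  have "level (Complex (Re x) (Im x)) \<le> level (Complex (Re y) (Im x))"
    using assms(1)
  proof (induction rule: Bolzano)
    case (trans a b c) then show ?case by simp
  next
    case (local c)
    let ?z = "Complex c (Im x)"
    obtain e where e: "e > 0" "\<forall>R\<in>\<Lambda>. R \<inter> ball ?z e \<noteq> {} \<longrightarrow> ?z \<in> R" using star by blast
    have cmp: "level (Complex a (Im x)) \<le> level ?z \<and> a \<le> c \<or> level ?z \<le> level (Complex a (Im x)) \<and> c \<le> a"
      if a: "\<bar>a - c\<bar> < e" for a
    proof -
      let ?w = "Complex a (Im x)"
      obtain R where R: "R \<in> \<Lambda>" "?w \<in> R" using cover by blast
      have "dist ?z ?w = \<bar>a - c\<bar>" by (simp add: dist_norm cmod_def abs_minus_commute)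
      then have "?z \<in> R" using e R a by (metis disjoint_iff mem_ball)
      then have "level ?w - level ?z = tile_level R ?w - tile_level R ?z" using level_tile R by blast
      then show ?thesis
        using tile_level_mono[OF tile_rhombus[OF R(1)], of ?w ?z]
          tile_level_mono[OF tile_rhombus[OF R(1)], of ?z ?w] by (cases "a \<le> c") auto
    qed
    show ?case
    proof (rule exI[of _ e], intro conjI allI impI)
      fix a b assume ab: "a \<le> c \<and> c \<le> b \<and> b - a < e"
      then have "level (Complex a (Im x)) \<le> level ?z" "level ?z \<le> level (Complex b (Im x))"
        using cmp[of a] cmp[of b] by auto
      then show "level (Complex a (Im x)) \<le> level (Complex b (Im x))" by simp
    qed (rule e)
  qed
  then show ?thesis using assms(2) by (metis complex_surj)
qed

text \<open>
  The strip of \<open>p\<close> meets the horizontal line at height \<open>y\<close>. Being a rung of this strip is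
  expressed by the invariance of an arbitrary function \<open>h\<close> along strips.
\<close>

lemma rung_at_height:
  assumes p: "rung p" and h: "\<And>q. rung q \<Longrightarrow> h (up q) = h q"
  obtains q where "rung q" "Im q \<le> y" "y < Im (up q)" "h q = h p"
proof -
  obtain r where r: "r > 0" "\<And>j. Im ((up ^^ j) p) \<ge> Im p + real j * r"
    "\<And>j. Im ((down ^^ j) p) \<le> Im p - real j * r" using orbit_heights p by metis
  obtain n where "\<bar>y - Im p\<bar> / r < real n" using reals_Archimedean2 by blast
  then have n: "\<bar>y - Im p\<bar> < real n * r" using r(1) by (simp add: field_simps)
  have hu: "h ((up ^^ j) p) = h p" for j
    by (induction j) (simp_all add: h rung_orbit p)
  have hd: "h ((down ^^ j) p) = h p" for j
  proof (induction j)
    case (Suc j)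
    have "rung ((down ^^ j) p)" using rung_orbit(2) p .
    then have "h (up (down ((down ^^ j) p))) = h (down ((down ^^ j) p))"
      using h strip_tile_adjacent(2) down(1) by blast
    then show ?case using Suc up_down[OF \<open>rung ((down ^^ j) p)\<close>] by simp
  qed simp
  show thesis
  proof (cases "Im p \<le> y")
    case True
    define m where "m = (LEAST j. y < Im ((up ^^ j) p))"
    have ex: "y < Im ((up ^^ n) p)" using n r(2)[of n] by linarith
    have m: "y < Im ((up ^^ m) p)" unfolding m_def by (rule LeastI[of _ n]) (rule ex)
    then obtain j where j: "m = Suc j" using True by (cases m) auto
    then have "\<not> y < Im ((up ^^ j) p)" using not_less_Least[of j "\<lambda>j. y < Im ((up ^^ j) p)"] m_def by simp
    then show thesis using that[of "(up ^^ j) p"] rung_orbit(1)[OF p] m j hu by simp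
  next
    case False
    define m where "m = (LEAST j. Im ((down ^^ j) p) \<le> y)"
    have ex: "Im ((down ^^ n) p) \<le> y" using n r(3)[of n] by linarith
    have m: "Im ((down ^^ m) p) \<le> y" unfolding m_def by (rule LeastI[of _ n]) (rule ex)
    then obtain j where j: "m = Suc j" using False by (cases m) auto
    then have "\<not> Im ((down ^^ j) p) \<le> y" using not_less_Least[of j "\<lambda>j. Im ((down ^^ j) p) \<le> y"] m_def by simp
    then show thesis
      using that[of "(down ^^ m) p"] rung_orbit(2)[OF p, of m] m hd[of m] up_down[OF rung_orbit(2)[OF p, of j]] j by simp
  qed
qed

text \<open>
  Compare the strip of \<open>p'\<close> with that of \<open>p\<close> on the horizontal line through \<open>p\<close>. The left
  boundary of either strip is the rightmost point with the given level on this line, since the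
  level is monotone and increases strictly inside a strip. Hence the boundaries meet at \<open>p\<close>, and
  \<open>p\<close> belongs to both strips.
\<close>

lemma same_level_same_strip:
  assumes rungs: "rung p" "rung p'" and lev: "level p = level p'"
    and h: "\<And>q. rung q \<Longrightarrow> h (up q) = h q"
  shows "h p = h p'"
proof -
  have "level (up q) = level q" if "rung q" for q
    using level_strip_tile[OF up(1)[OF that], of 0 1] by simp
  then have "(h (up q), level (up q)) = (h q, level q)" if "rung q" for q using h that by simp
  then obtain q where q: "rung q" "Im q \<le> Im p" "Im p < Im (up q)" "(h q, level q) = (h p', level p')"
    using rung_at_height[OF rungs(2), of "\<lambda>q. (h q, level q)" "Im p"] by metis
  define v where "v = up q - q"
  define t where "t = (Im p - Im q) / Im v"
  have tile: "strip_tile q (up q)" using up(1)[OF q(1)] .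
  have v: "rhombus_sides 1 v" "rhomb q 1 v \<in> \<Lambda>" "Im v > 0"
    using tile up(2)[OF q(1)] by (simp_all add: strip_tile_def v_def)
  have t: "0 \<le> t" "t < 1" using q(2,3) v(3) by (simp_all add: t_def v_def field_simps)
  define x where "x = q + of_real t * v"
  have Imx: "Im x = Im p" using v(3) by (simp add: x_def t_def)
  have lx: "level (x + of_real s) = level p + s" if "0 \<le> s" "s \<le> 1" for s
    using level_strip_tile[OF tile that t(1)] t(2) q(4) lev by (simp add: x_def v_def algebra_simps)
  have lp: "level (p + of_real s) = level p + s" if "0 \<le> s" "s \<le> 1" for s
    using level_strip_tile[OF up(1)[OF rungs(1)] that, of 0] by simp
  \<comment> \<open>Moving right from either \<open>x\<close> or \<open>p\<close> raises the level at once.\<close>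
  have "\<not> Re x < Re p"
  proof
    assume less: "Re x < Re p"
    define s where "s = min 1 (Re p - Re x)"
    have s: "0 < s" "s \<le> 1" "Re x + s \<le> Re p" using less by (auto simp: s_def)
    have "level (x + of_real s) \<le> level p" using s Imx by (intro level_mono) auto
    then show False using lx s by simp
  qed
  moreover have "\<not> Re p < Re x"
  proof
    assume less: "Re p < Re x"
    define s where "s = min 1 (Re x - Re p)"
    have s: "0 < s" "s \<le> 1" "Re p + s \<le> Re x" using less by (auto simp: s_def)
    have "level (p + of_real s) \<le> level x" using s Imx by (intro level_mono) auto
    then show False using lp lx[of 0] s by simp
  qed
  ultimately have px: "p = q + of_real 0 * 1 + of_real t * v"
    using Imx by (simp add: complex_eq_iff x_def)
  then have "p \<in> rhomb q 1 v" using rhomb_memI[of 0 t q 1 v] t by auto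
  then have "p \<in> {q, q + 1, q + 1 + v, q + v}"
    using vert_corner[OF _ _ v(2,1)] rungs(1) adjacent_verts unfolding rung_def by blast
  moreover have "p \<noteq> q + of_real 1 * 1 + of_real 0 * v" "p \<noteq> q + of_real 1 * 1 + of_real 1 * v"
    "p \<noteq> q + of_real 0 * 1 + of_real 1 * v"
    using coordinates_unique[OF v(1)] px t by (metis zero_neq_one less_irrefl)+
  ultimately have "p = q" by simp
  then show ?thesis using q(4) by simp
qed

end

section \<open>Solving the edge equations\<close>

context rhombic_tiling
begin

lemma adjacent_horizontal_iff:
  "adjacent \<Lambda> a b \<Longrightarrow> Im (b - a) = 0 \<longleftrightarrow> b = a + 1 \<or> a = b + 1"
proof -
  assume "adjacent \<Lambda> a b"
  then have "norm (b - a) = 1" by (rule adjacent_norm)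
  then have "Im (b - a) = 0 \<Longrightarrow> b - a = 1 \<or> b - a = - 1" using unit_complex_Im_0 by blast
  then show ?thesis by (auto simp: complex_eq_iff)
qed

text \<open>
  The required ratios multiply to \<open>1\<close> around each tile because they depend on the direction of
  the edge only. To apply the additive Poincare lemma one passes to logarithms, chosen
  antisymmetrically: the principal value for rising edges, its negative for the reversed ones,
  and \<open>0\<close> on horizontal edges.
\<close>

lemma discrete_exponential:
  obtains E where "\<And>z. E z \<noteq> 0"
    "\<And>a b. adjacent \<Lambda> a b \<Longrightarrow> Im (b - a) \<noteq> 0 \<Longrightarrow> E b * (1 - (b - a)) = E a * (1 + (b - a))"
proof -
  define l where "l d = (if Im d > 0 then Ln ((1 + d) / (1 - d))
    else if Im d < 0 then - Ln ((1 - d) / (1 + d)) else 0)" for d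
  obtain P where P: "\<And>a b. adjacent \<Lambda> a b \<Longrightarrow> P b - P a = l (b - a)"
  proof (rule edge_potential[where w = "\<lambda>a b. l (b - a)"])
    fix a b :: complex
    have "l (- d) = - l d" for d unfolding l_def by simp
    from this[of "b - a"] show "l (a - b) = - l (b - a)" by simp
  next
    fix p u v :: complex
    show "l (p + u - p) + l (p + u + v - (p + u)) = l (p + v - p) + l (p + u + v - (p + v))"
      by (simp add: algebra_simps)
  qed blast
  have l: "exp (l d) * (1 - d) = 1 + d" if d: "Im d \<noteq> 0" for d
  proof -
    have "1 - d \<noteq> 0" "1 + d \<noteq> 0" using d by (auto simp: complex_eq_iff)
    then show ?thesis using d by (cases "Im d > 0") (simp_all add: l_def exp_minus)
  qed
  have "exp (P b) * (1 - (b - a)) = exp (P a) * (1 + (b - a))"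
    if "adjacent \<Lambda> a b" "Im (b - a) \<noteq> 0" for a b
  proof -
    have "P b = P a + l (b - a)" using P[OF that(1)] by (simp add: algebra_simps)
    then have "exp (P b) = exp (P a) * exp (l (b - a))" by (simp add: exp_add)
    then show ?thesis using l[OF that(2)] by (simp add: mult.assoc)
  qed
  then show thesis using that[of "\<lambda>z. exp (P z)"] by simp
qed

text \<open>
  Variation of constants: \<open>A\<close> is the increment which the edge equation prescribes for \<open>g\<close> in
  \<open>f = E g\<close>, and \<open>T\<close> the increment assigned to \<open>g\<close> across the strips. The function \<open>G\<close> is the
  value that the equation on a rung requires of \<open>g\<close> at its left end; it has the increments \<open>A\<close>
  along the left side of a strip, so the error \<open>h\<close> is constant on each strip.
\<close>

lemma edge_equations_solvable:
  assumes cr: "cauchy_riemann F"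
  obtains f where
    "\<And>a b. adjacent \<Lambda> a b \<Longrightarrow> (b - a - 1) * f b + (b - a + 1) * f a = 2 * (F b - F a)"
proof -
  obtain E where E0: "\<And>z. E z \<noteq> 0"
    and E: "\<And>a b. adjacent \<Lambda> a b \<Longrightarrow> Im (b - a) \<noteq> 0 \<Longrightarrow> E b * (1 - (b - a)) = E a * (1 + (b - a))"
    using discrete_exponential by blast
  define A where "A a b = - 2 * (F b - F a) / (E a * (1 + (b - a)))" for a b
  have A: "A a b * (E a * (1 + (b - a))) = - 2 * (F b - F a)" if "Im (b - a) \<noteq> 0" for a b
  proof -
    have "1 + (b - a) \<noteq> 0" using that by (auto simp: complex_eq_iff)
    then show ?thesis using E0[of a] by (simp add: A_def)
  qed
  have A_anti: "A b a = - A a b" if ab: "adjacent \<Lambda> a b" "Im (b - a) \<noteq> 0" for a b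
  proof -
    have "E b * (1 + (a - b)) = E a * (1 + (b - a))" using E[OF ab] by (simp add: algebra_simps)
    then show ?thesis unfolding A_def by (metis minus_diff_eq mult_minus_right minus_divide_left)
  qed
  have A_closed: "A p (p + u) + A (p + u) (p + u + v) = A p (p + v) + A (p + v) (p + u + v)"
    if t: "rhomb p u v \<in> \<Lambda>" "rhombus_sides u v" and Im: "Im u \<noteq> 0" "Im v \<noteq> 0" for p u v
  proof -
    note adj = rhomb_adjacent[OF t]
    have e: "E (p + u) * (1 - u) = E p * (1 + u)" "E (p + v) * (1 - v) = E p * (1 + v)"
      using E[OF adj(1)] E[OF adj(2)] Im by simp_all
    have a: "A p (p + u) * (E p * (1 + u)) = - 2 * (F (p + u) - F p)"
      "A p (p + v) * (E p * (1 + v)) = - 2 * (F (p + v) - F p)"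
      "A (p + u) (p + u + v) * (E (p + u) * (1 + v)) = - 2 * (F (p + u + v) - F (p + u))"
      "A (p + v) (p + u + v) * (E (p + v) * (1 + u)) = - 2 * (F (p + u + v) - F (p + v))"
      using A[of "p + u" p] A[of "p + v" p] A[of "p + u + v" "p + u"] A[of "p + u + v" "p + v"] Im
      by (simp_all add: algebra_simps)
    have nz: "E p \<noteq> 0" "1 + u \<noteq> 0" "1 + v \<noteq> 0" using E0 Im by (auto simp: complex_eq_iff)
    have "(v - u) * (F (p + u + v) - F p) = (u + v) * (F (p + v) - F (p + u))"
      by (rule cauchy_riemannD[OF cr t])
    then have "(A p (p + u) + A (p + u) (p + u + v)) * (E p * (1 + u) * (1 + v))
        = (A p (p + v) + A (p + v) (p + u + v)) * (E p * (1 + u) * (1 + v))"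
      using e a by algebra
    then show ?thesis using nz by simp
  qed
  obtain T where T: "\<And>p. rung p \<Longrightarrow> T (up p) - T p = A (p + 1) (up p + 1) - A p (up p)"
    using strip_summation[of "\<lambda>p. A (p + 1) (up p + 1) - A p (up p)"] by blast
  have T_tile: "T q - T p = A (p + 1) (q + 1) - A p q" if t: "strip_tile p q" for p q
  proof (cases "Im q > Im p")
    case True
    then have "up p = q" using strip_tile_up t by blast
    then show ?thesis using T[of p] strip_tile_adjacent(1)[OF t] by simp
  next
    case False
    have Im: "Im q \<noteq> Im p" by (rule strip_tile_Im[OF t])
    then have "up q = p" using strip_tile_up[OF strip_tile_sym[OF t]] False by simp
    then have "T p - T q = A (q + 1) (p + 1) - A q p" using T[of q] strip_tile_adjacent(2)[OF t] by simp
    moreover have "A q p = - A p q" "A (q + 1) (p + 1) = - A (p + 1) (q + 1)"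
      using A_anti[of p q] A_anti[of "p + 1" "q + 1"] strip_tile_adjacent(3,4)[OF t] Im by simp_all
    ultimately show ?thesis by (simp add: algebra_simps)
  qed
  define w where "w a b = (if b = a + 1 then T a else if a = b + 1 then - T b else A a b)" for a b
  have w1: "w a (a + 1) = T a" "w (a + 1) a = - T a" for a
    by (simp_all add: w_def)
  have w2: "w a b = A a b" if "Im (b - a) \<noteq> 0" for a b
    using that by (auto simp: w_def)
  have w_strip: "w (p + 1) (q + 1) = w p q + w q (q + 1) - w p (p + 1)" if "strip_tile p q" for p q
  proof -
    have "w (p + 1) (q + 1) = A (p + 1) (q + 1)" "w p q = A p q"
      using strip_tile_Im[OF that] by (simp_all add: w2)
    moreover have "x = y + s - t" if "s - t = x - y" for x y s t :: complex
      using that by (simp add: algebra_simps)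
    ultimately show ?thesis using T_tile[OF that] unfolding w1(1) by simp
  qed
  have w_anti: "w b a = - w a b" if ab: "adjacent \<Lambda> a b" for a b
  proof (cases "Im (b - a) = 0")
    case True
    then show ?thesis using adjacent_horizontal_iff[OF ab] w1 by (metis minus_minus)
  next
    case False
    then have "Im (a - b) \<noteq> 0" by simp
    then show ?thesis using A_anti[OF ab False] w2 False by simp
  qed
  have horizontal: "w p (p + u) + w (p + u) (p + u + v) = w p (p + v) + w (p + v) (p + u + v)"
    if t: "rhomb p u v \<in> \<Lambda>" "rhombus_sides u v" and Im: "Im u = 0" for p u v
  proof -
    have "u = 1 \<or> u = - 1" using t(2) Im unit_complex_Im_0 by (simp add: rhombus_sides_def)
    then show ?thesis
    proof
      assume u: "u = 1"
      then have "strip_tile p (p + v)" using t by (simp add: strip_tile_def)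
      from w_strip[OF this] show ?thesis by (simp add: u algebra_simps)
    next
      assume u: "u = - 1"
      define q where "q = p - 1"
      have p: "p = q + 1" by (simp add: q_def)
      have "rhomb p u v = rhomb q 1 v" "rhombus_sides 1 v"
        using rhomb_shift[of p u v] rhombus_sides_neg[OF t(2)] by (simp_all add: u p)
      then have s: "strip_tile q (q + v)" using t(1) by (simp add: strip_tile_def)
      show ?thesis
        using w_strip[OF s] w1[of q] w1[of "q + v"] unfolding u p by (simp add: algebra_simps)
    qed
  qed
  obtain g where g: "\<And>a b. adjacent \<Lambda> a b \<Longrightarrow> g b - g a = w a b"
  proof (rule edge_potential[of w])
    fix p u v assume t: "rhomb p u v \<in> \<Lambda>" "rhombus_sides u v"
    consider "Im u = 0" | "Im v = 0" | "Im u \<noteq> 0" "Im v \<noteq> 0" by blast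
    then show "w p (p + u) + w (p + u) (p + u + v) = w p (p + v) + w (p + v) (p + u + v)"
    proof cases
      case 1
      then show ?thesis using horizontal t by blast
    next
      case 2
      then show ?thesis
        using horizontal[of p v u] t rhombus_sides_swap rhomb_swap[of p u v] by (simp add: algebra_simps)
    next
      case 3
      then show ?thesis using A_closed[OF t] by (simp add: w2)
    qed
  qed (use w_anti in auto)
  define G where "G p = (F (p + 1) - F p) / E p" for p
  define h where "h p = g p - G p" for p
  have G_tile: "G q - G p = A p q" if t: "strip_tile p q" for p q
  proof -
    define v where "v = q - p"
    have v: "rhomb p 1 v \<in> \<Lambda>" "rhombus_sides 1 v" using t by (simp_all add: strip_tile_def v_def)
    have q: "q = p + v" by (simp add: v_def)
    have Im: "Im v \<noteq> 0" using rhombus_sides_1[OF v(2)] by simp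
    have e: "E q * (1 - v) = E p * (1 + v)"
      using E[OF strip_tile_adjacent(3)[OF t]] Im by (simp add: q)
    have a: "A p q * (E p * (1 + v)) = - 2 * (F q - F p)" using A[of q p] Im by (simp add: q)
    have b: "G q * E q = F (q + 1) - F q" "G p * E p = F (p + 1) - F p" using E0 by (simp_all add: G_def)
    have c: "(v - 1) * (F (q + 1) - F p) = (1 + v) * (F q - F (p + 1))"
      using cauchy_riemannD[OF cr v] by (simp add: q add.commute add.left_commute)
    have nz: "E p \<noteq> 0" "1 + v \<noteq> 0" using E0 Im by (auto simp: complex_eq_iff)
    have "(G q - G p) * (E p * (1 + v)) = A p q * (E p * (1 + v))"
      using e a b c by algebra
    then show ?thesis using nz by simp
  qed
  have h_up: "h (up p) = h p" if p: "rung p" for p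
  proof -
    have t: "strip_tile p (up p)" by (rule up(1)[OF p])
    have "g (up p) - g p = A p (up p)"
      using g[OF strip_tile_adjacent(3)[OF t]] w2 strip_tile_Im[OF t] by simp
    then show ?thesis using G_tile[OF t] by (simp add: h_def algebra_simps)
  qed
  define \<kappa> where "\<kappa> z = h (SOME p. rung p \<and> level p = level z)" for z
  have \<kappa>_rung: "\<kappa> p = h p" if p: "rung p" for p
  proof -
    have "rung (SOME q. rung q \<and> level q = level p) \<and> level (SOME q. rung q \<and> level q = level p) = level p"
      by (rule someI[of _ p]) (use p in simp)
    then show ?thesis unfolding \<kappa>_def using same_level_same_strip[OF _ p, where h = h] h_up by blast
  qed
  have \<kappa>_edge: "\<kappa> b = \<kappa> a" if "adjacent \<Lambda> a b" "Im (b - a) \<noteq> 0" for a b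
    using level_nonhorizontal_edge[OF that] by (simp add: \<kappa>_def)
  define f where "f z = E z * (g z - \<kappa> z)" for z
  have f_rung: "f p = F (p + 1) - F p" if "rung p" for p
    using \<kappa>_rung[OF that] E0[of p] by (simp add: f_def h_def G_def)
  have "(b - a - 1) * f b + (b - a + 1) * f a = 2 * (F b - F a)" if ab: "adjacent \<Lambda> a b" for a b
  proof (cases "Im (b - a) = 0")
    case True
    then consider "b = a + 1" | "a = b + 1" using adjacent_horizontal_iff[OF ab] by blast
    then show ?thesis
    proof cases
      case 1
      then have "rung a" using ab by (simp add: rung_def)
      then show ?thesis using f_rung[of a] 1 by simp
    next
      case 2
      then have "rung b" using adjacent_sym[OF ab] by (simp add: rung_def)
      then show ?thesis by (simp add: 2 f_rung ring_distribs)
    qed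
  next
    case False
    have gA: "g b - g a = A a b" using g[OF ab] w2[OF False] by simp
    have "(b - a - 1) * f b + (b - a + 1) * f a =
        E a * (1 + (b - a)) * (g a - \<kappa> a) - E b * (1 - (b - a)) * (g b - \<kappa> a)"
      unfolding f_def \<kappa>_edge[OF ab False] by (simp add: algebra_simps)
    also have "\<dots> = - ((g b - g a) * (E a * (1 + (b - a))))"
      unfolding E[OF ab False] by (simp add: algebra_simps)
    also have "\<dots> = 2 * (F b - F a)" unfolding gA A[OF False] by simp
    finally show ?thesis .
  qed
  then show thesis by (rule that)
qed

lemma Z_plus_surjective:
  assumes F: "F \<in> DA_space \<Lambda>" "F 0 = 0" and zero: "0 \<in> verts \<Lambda>"
  shows "\<exists>f\<in>DA_space \<Lambda>. Z_plus \<Lambda> f = F"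
proof -
  have "cauchy_riemann F" using F(1) discrete_analytic_iff by (simp add: DA_space_def)
  then obtain f0 where f0: "\<And>a b. adjacent \<Lambda> a b \<Longrightarrow>
      (b - a - 1) * f0 b + (b - a + 1) * f0 a = 2 * (F b - F a)"
    using edge_equations_solvable by blast
  define f where "f z = (if z \<in> verts \<Lambda> then f0 z else 0)" for z
  have off: "F z = 0 \<and> f z = 0" if "z \<notin> verts \<Lambda>" for z
    using that F(1) by (simp add: f_def DA_space_def)
  have edge: "(b - a - 1) * f b + (b - a + 1) * f a = 2 * (F b - F a)" if "adjacent \<Lambda> a b" for a b
    using f0[OF that] adjacent_verts[OF that] by (simp add: f_def)
  show ?thesis using Z_plus_eqI[OF zero F(2) off edge] by blast
qed

end

theorem theorem3p2:
  fixes \<Lambda> :: "complex set set"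
  assumes "rhombic_lattice \<Lambda>"
    and "0 \<in> verts \<Lambda>"
    and "\<And>z. z \<in> verts \<Lambda> \<Longrightarrow>
           \<exists>N zs. lattice_path \<Lambda> zs \<and> N \<ge> 1 \<and> length zs = N + 1 \<and> zs ! 0 = z \<and>
             (\<forall>n\<in>{1..N - 1}. zs ! n - zs ! (n - 1) \<noteq> 1 \<and> zs ! n - zs ! (n - 1) \<noteq> - 1) \<and>
             zs ! N - zs ! (N - 1) = 1"
  shows "{f \<in> DA_space \<Lambda>. Z_plus \<Lambda> f = (\<lambda>_. 0)} = {\<lambda>_. 0}
       \<and> Z_plus \<Lambda> ` DA_space \<Lambda> = {f \<in> DA_space \<Lambda>. f 0 = 0}"
proof -
  interpret rhombic_tiling \<Lambda> by unfold_locales (rule assms(1))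
  have "(\<lambda>_. 0) \<in> DA_space \<Lambda>" "Z_plus \<Lambda> (\<lambda>_. 0) = (\<lambda>_. 0)"
    using Z_plus_eqI[OF assms(2), of "\<lambda>_. 0" "\<lambda>_. 0"] by simp_all
  then have "{f \<in> DA_space \<Lambda>. Z_plus \<Lambda> f = (\<lambda>_. 0)} = {\<lambda>_. 0}"
    using Z_plus_injective[OF _ _ assms(2,3)] by blast
  moreover have "Z_plus \<Lambda> ` DA_space \<Lambda> = {f \<in> DA_space \<Lambda>. f 0 = 0}"
    using Z_plus_in_DA_space[OF _ assms(2)] Z_plus_surjective[OF _ _ assms(2)] by blast
  ultimately show ?thesis ..
qed

end
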